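(* Let $\mu$ be a Gibbs distribution on $[q]^V$ (for a graph $G=(V,E)$) satisfying $C$-coupling independence, and let $R>0$ be an integer. For any $\Lambda\subseteq V$ and any two partial configurations $\sigma,\tau\in[q]^\Lambda$ that disagree only at some vertex $v\in\Lambda$, there is a coupling $\mathcal C$ of $\mu^\sigma$ and $\mu^\tau$ such that $$\mathbb E_{(\sigma',\tau')\sim\mathcal C}\Big[\sum_{u\in S_R(v)}\mathbf 1[\sigma'(u)\ne\tau'(u)]\Big]\le 2C\left(\tfrac12\right)^{\lceil R/(2C)\rceil}.$$ As a consequence, $\mu$ satisfies total influence decay with rate $\delta(x)=2C\cdot 2^{-\lceil x/(2C)\rceil}$, i.e. for all such $\sigma,\tau,v$ and every integer $\ell>0$, $\sum_{u\in S_\ell(v)}d_{TV}(\mu^\sigma_u,\mu^\tau_u)\le 2C\cdot2^{-\lceil \ell/(2C)\rceil}$.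
   Context: The Gibbs distribution $\mu$ comes from a spin system on $G=(V,E)$: $\mu(\sigma)\propto\prod_{\{u,v\}\in E}A_E(\sigma(u),\sigma(v))\prod_{v}A_V(\sigma(v))$ with $A_E\in\mathbb{R}_{\ge0}^{q\times q}$, $A_V\in\mathbb{R}_{\ge0}^q$. For $\Lambda\subseteq V$ and a (possibly infeasible) $\sigma\in[q]^\Lambda$, $\mu^\sigma(\tau)\propto\mathbf 1[\tau|_\Lambda=\sigma]\prod_{v\notin\Lambda}A_V(\tau(v))\prod_{\{u,v\}\in E,u\notin\Lambda,v\in\Lambda}A_E(\tau(u),\sigma(v))\prod_{\{u,v\}\in E,u,v\notin\Lambda}A_E(\tau(u),\tau(v))$ for $\tau\in[q]^V$ (assumed well defined, i.e. the normaliser is positive), and $\mu^\sigma_u$ is its marginal at $u$. $C$-coupling independence: for every $\Lambda\subseteq V$ and $\sigma,\tau\in[q]^\Lambda$ differing in exactly one vertex, there is a coupling $(X,Y)$ of $\mu^\sigma,\mu^\tau$ with expected Hamming distance (number of vertices where $X,Y$ differ) at most $C$. $S_\ell(v)=\{u\in V:\mathrm{dist}_G(u,v)=\ell\}$ is the sphere of radius $\ell$ around $v$ in graph distance; $d_{TV}$ is total variation distance. *)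

theory Defs
  imports "HOL-Analysis.Analysis"
begin

text \<open>Spin system on a finite simple graph G = (V, E).  Spins are [q] = {0..<q}.
  Edges are given as a finite set Ed of ordered pairs, each undirected edge {u,w}
  listed exactly once (in an arbitrary orientation); the edge factor of the edge
  (a,b) is Aedge (x a) (x b).  Configurations on a set L are the functions in
  PiE L (\<lambda>_. {..<q}).\<close>

definition simple_graph :: "'v set \<Rightarrow> ('v \<times> 'v) set \<Rightarrow> bool" where
  "simple_graph V Ed \<longleftrightarrow> finite V \<and> Ed \<subseteq> V \<times> V \<and>
     (\<forall>a b. (a, b) \<in> Ed \<longrightarrow> a \<noteq> b \<and> (b, a) \<notin> Ed)"

definition spin_system :: "nat \<Rightarrow> 'v set \<Rightarrow> ('v \<times> 'v) set \<Rightarrow> (nat \<Rightarrow> nat \<Rightarrow> real)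
    \<Rightarrow> (nat \<Rightarrow> real) \<Rightarrow> bool" where
  "spin_system q V Ed Aedge Avert \<longleftrightarrow> simple_graph V Ed \<and>
     (\<forall>i<q. \<forall>j<q. Aedge i j \<ge> 0) \<and> (\<forall>i<q. Avert i \<ge> 0)"

definition configs :: "nat \<Rightarrow> 'v set \<Rightarrow> ('v \<Rightarrow> nat) set" where
  "configs q L = PiE L (\<lambda>_. {..<q})"

definition pin_weight :: "'v set \<Rightarrow> ('v \<times> 'v) set \<Rightarrow> (nat \<Rightarrow> nat \<Rightarrow> real)
    \<Rightarrow> (nat \<Rightarrow> real) \<Rightarrow> 'v set \<Rightarrow> ('v \<Rightarrow> nat) \<Rightarrow> ('v \<Rightarrow> nat) \<Rightarrow> real" where
  "pin_weight V Ed Aedge Avert L sig x =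
     (if (\<forall>w\<in>L. x w = sig w) then
        (\<Prod>w\<in>V - L. Avert (x w)) *
        (\<Prod>e\<in>{e\<in>Ed. \<not> (fst e \<in> L \<and> snd e \<in> L)}. Aedge (x (fst e)) (x (snd e)))
      else 0)"

definition pin_Z :: "nat \<Rightarrow> 'v set \<Rightarrow> ('v \<times> 'v) set \<Rightarrow> (nat \<Rightarrow> nat \<Rightarrow> real)
    \<Rightarrow> (nat \<Rightarrow> real) \<Rightarrow> 'v set \<Rightarrow> ('v \<Rightarrow> nat) \<Rightarrow> real" where
  "pin_Z q V Ed Aedge Avert L sig = (\<Sum>x\<in>configs q V. pin_weight V Ed Aedge Avert L sig x)"

text \<open>The conditional Gibbs distribution mu^sig as a probability mass function on configs q V
  (meaningful when pin_Z > 0).\<close>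
definition gibbs_pin :: "nat \<Rightarrow> 'v set \<Rightarrow> ('v \<times> 'v) set \<Rightarrow> (nat \<Rightarrow> nat \<Rightarrow> real)
    \<Rightarrow> (nat \<Rightarrow> real) \<Rightarrow> 'v set \<Rightarrow> ('v \<Rightarrow> nat) \<Rightarrow> ('v \<Rightarrow> nat) \<Rightarrow> real" where
  "gibbs_pin q V Ed Aedge Avert L sig x =
     (if x \<in> configs q V then pin_weight V Ed Aedge Avert L sig x / pin_Z q V Ed Aedge Avert L sig else 0)"

definition gibbs_marginal :: "nat \<Rightarrow> 'v set \<Rightarrow> ('v \<times> 'v) set \<Rightarrow> (nat \<Rightarrow> nat \<Rightarrow> real)
    \<Rightarrow> (nat \<Rightarrow> real) \<Rightarrow> 'v set \<Rightarrow> ('v \<Rightarrow> nat) \<Rightarrow> 'v \<Rightarrow> nat \<Rightarrow> real" where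
  "gibbs_marginal q V Ed Aedge Avert L sig u c =
     (\<Sum>x\<in>{x\<in>configs q V. x u = c}. gibbs_pin q V Ed Aedge Avert L sig x)"

definition dtv_spin :: "nat \<Rightarrow> (nat \<Rightarrow> real) \<Rightarrow> (nat \<Rightarrow> real) \<Rightarrow> real" where
  "dtv_spin q P Q = (1/2) * (\<Sum>c<q. \<bar>P c - Q c\<bar>)"

definition is_coupling :: "'a set \<Rightarrow> ('a \<times> 'a \<Rightarrow> real) \<Rightarrow> ('a \<Rightarrow> real) \<Rightarrow> ('a \<Rightarrow> real) \<Rightarrow> bool" where
  "is_coupling Om p P Q \<longleftrightarrow>
     (\<forall>z. p z \<ge> 0) \<and> (\<forall>z. z \<notin> Om \<times> Om \<longrightarrow> p z = 0) \<and>
     (\<forall>x\<in>Om. (\<Sum>y\<in>Om. p (x, y)) = P x) \<and>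
     (\<forall>y\<in>Om. (\<Sum>x\<in>Om. p (x, y)) = Q y)"

definition exp_disagree :: "('v \<Rightarrow> nat) set \<Rightarrow> (('v \<Rightarrow> nat) \<times> ('v \<Rightarrow> nat) \<Rightarrow> real) \<Rightarrow> 'v set \<Rightarrow> real" where
  "exp_disagree Om p S = (\<Sum>(x, y)\<in>Om \<times> Om. p (x, y) * real (card {u\<in>S. x u \<noteq> y u}))"

definition differ_exactly_one :: "'v set \<Rightarrow> ('v \<Rightarrow> nat) \<Rightarrow> ('v \<Rightarrow> nat) \<Rightarrow> bool" where
  "differ_exactly_one L sig tau \<longleftrightarrow> card {w\<in>L. sig w \<noteq> tau w} = 1"

text \<open>C-coupling independence (pinnings for which mu^sig is well defined, i.e. pin_Z > 0).\<close>
definition coupling_independence :: "nat \<Rightarrow> 'v set \<Rightarrow> ('v \<times> 'v) set \<Rightarrow> (nat \<Rightarrow> nat \<Rightarrow> real)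
    \<Rightarrow> (nat \<Rightarrow> real) \<Rightarrow> real \<Rightarrow> bool" where
  "coupling_independence q V Ed Aedge Avert C \<longleftrightarrow>
     (\<forall>L sig tau. L \<subseteq> V \<longrightarrow> sig \<in> configs q L \<longrightarrow> tau \<in> configs q L \<longrightarrow>
        differ_exactly_one L sig tau \<longrightarrow>
        pin_Z q V Ed Aedge Avert L sig > 0 \<longrightarrow> pin_Z q V Ed Aedge Avert L tau > 0 \<longrightarrow>
        (\<exists>p. is_coupling (configs q V) p (gibbs_pin q V Ed Aedge Avert L sig) (gibbs_pin q V Ed Aedge Avert L tau)
             \<and> exp_disagree (configs q V) p V \<le> C))"

definition adj_rel :: "('v \<times> 'v) set \<Rightarrow> ('v \<times> 'v) set" where
  "adj_rel Ed = Ed \<union> Ed\<inverse>"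

definition graph_sphere :: "('v \<times> 'v) set \<Rightarrow> 'v \<Rightarrow> nat \<Rightarrow> 'v set" where
  "graph_sphere Ed v l = {u. (v, u) \<in> adj_rel Ed ^^ l \<and> (\<forall>k<l. (v, u) \<notin> adj_rel Ed ^^ k)}"

end

theory Submission
  imports Defs
begin

text \<open>Let \<open>f R\<close> be the least cost, uniformly over feasible pairs of pinnings that differ at a single
  vertex \<open>v\<close>, of coupling the two Gibbs measures, where the cost counts disagreements at distance at
  least \<open>R\<close> from \<open>v\<close>. Take the coupling given by coupling independence, let \<open>E r\<close> be its expected
  number of disagreements on the sphere of radius \<open>r\<close>, reveal both configurations there, and recouple
  the rest. If they agree on the sphere, the rest can be coupled perfectly beyond it. Otherwise
  let \<open>D\<close> be the set of disagreements. Changing one vertex of \<open>D\<close> at a time from the first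
  configuration to the second may run through pinnings of zero weight, so instead \<open>D\<close> is unpinned one
  vertex at a time, then the spin of \<open>v\<close> is switched, and then \<open>D\<close> is pinned again. All these
  pinnings are feasible, and \<open>f R \<le> E r * (2 * f (R - r) + f R)\<close> follows.

  The \<open>E r\<close> with \<open>0 < r < R\<close>, the expected number of disagreements at distance at least \<open>R\<close>, and the
  sure disagreement at \<open>v\<close> add up to at most \<open>C\<close>. This forces
  \<open>f R \<le> 21/20 * C * (1 - 3 / (8 * C)) ^ R\<close>, which suffices because \<open>2 * 21/20 \<le> exp (3/4)\<close>.\<close>

section \<open>Transport cost on finite sets\<close>

text \<open>A bound on the cost of some coupling stands in for the optimal transport cost, so that
  bounds compose without an optimal coupling.\<close>

definition transport_le ::
  "'a set \<Rightarrow> ('a \<Rightarrow> 'a \<Rightarrow> real) \<Rightarrow> ('a \<Rightarrow> real) \<Rightarrow> ('a \<Rightarrow> real) \<Rightarrow> real \<Rightarrow> bool" where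
  "transport_le Om c P Q k \<longleftrightarrow>
     (\<exists>p. is_coupling Om p P Q \<and> (\<Sum>x\<in>Om. \<Sum>y\<in>Om. p (x, y) * c x y) \<le> k)"

lemma transport_le_mono:
  assumes "transport_le Om c P Q k" "k \<le> k'"
    and "\<And>x y. x \<in> Om \<Longrightarrow> y \<in> Om \<Longrightarrow> c' x y \<le> c x y"
  shows "transport_le Om c' P Q k'"
proof -
  obtain p where p: "is_coupling Om p P Q" "(\<Sum>x\<in>Om. \<Sum>y\<in>Om. p (x, y) * c x y) \<le> k"
    using assms(1) unfolding transport_le_def by blast
  have "(\<Sum>x\<in>Om. \<Sum>y\<in>Om. p (x, y) * c' x y) \<le> (\<Sum>x\<in>Om. \<Sum>y\<in>Om. p (x, y) * c x y)"
    using p(1) assms(3) unfolding is_coupling_def by (intro sum_mono mult_left_mono) auto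
  then show ?thesis using p assms(2) unfolding transport_le_def by fastforce
qed

lemma transport_le_sym:
  assumes "transport_le Om c P Q k" "\<And>x y. c x y = c y x"
  shows "transport_le Om c Q P k"
proof -
  obtain p where p: "is_coupling Om p P Q" "(\<Sum>x\<in>Om. \<Sum>y\<in>Om. p (x, y) * c x y) \<le> k"
    using assms(1) unfolding transport_le_def by blast
  have "(\<Sum>x\<in>Om. \<Sum>y\<in>Om. p (y, x) * c x y) = (\<Sum>x\<in>Om. \<Sum>y\<in>Om. p (x, y) * c x y)"
    by (subst sum.swap) (simp add: assms(2))
  moreover have "is_coupling Om (\<lambda>z. p (snd z, fst z)) Q P"
    using p(1) unfolding is_coupling_def by auto
  ultimately show ?thesis using p(2) unfolding transport_le_def
    by (intro exI[of _ "\<lambda>z. p (snd z, fst z)"]) simp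
qed

text \<open>On each fibre of \<open>f\<close> the two measures have the same mass
  \<open>M b\<close>, and the product of their restrictions divided by \<open>M b\<close> couples
  them there. All mass then sits on pairs with \<open>f x = f y\<close>, where the cost is at most
  0.\<close>

lemma transport_le_fibres:
  assumes fin: "finite Om"
    and P: "\<And>x. x \<in> Om \<Longrightarrow> P x \<ge> 0" and Q: "\<And>x. x \<in> Om \<Longrightarrow> Q x \<ge> 0"
    and marg: "\<And>b. (\<Sum>x\<in>{x\<in>Om. f x = b}. P x) = (\<Sum>x\<in>{x\<in>Om. f x = b}. Q x)"
    and c: "\<And>x y. x \<in> Om \<Longrightarrow> y \<in> Om \<Longrightarrow> f x = f y \<Longrightarrow> c x y \<le> 0"
  shows "transport_le Om c P Q 0"
proof -
  define M where "M b = (\<Sum>x\<in>{x\<in>Om. f x = b}. P x)" for b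
  have MQ: "M b = (\<Sum>x\<in>{x\<in>Om. f x = b}. Q x)" for b by (simp add: M_def marg)
  have M0: "M b \<ge> 0" for b unfolding M_def using P by (intro sum_nonneg) auto
  define p where "p z = (if fst z \<in> Om \<and> snd z \<in> Om \<and> f (fst z) = f (snd z)
                        then P (fst z) * Q (snd z) / M (f (fst z)) else 0)" for z
  \<comment> \<open>On a fibre of mass zero \<open>P\<close> vanishes, so the convention that
    division by zero gives zero does no harm; likewise for \<open>Q\<close> below.\<close>
  have PM: "P x * M (f x) / M (f x) = P x" if "x \<in> Om" for x
  proof (cases "M (f x) = 0")
    case True
    then have "P x = 0" unfolding M_def
      using that P fin by (subst (asm) sum_nonneg_eq_0_iff) auto
    then show ?thesis by simp
  qed simp
  have QM: "Q x * M (f x) / M (f x) = Q x" if "x \<in> Om" for x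
  proof (cases "M (f x) = 0")
    case True
    then have "Q x = 0" unfolding MQ
      using that Q fin by (subst (asm) sum_nonneg_eq_0_iff) auto
    then show ?thesis by simp
  qed simp
  have "(\<Sum>y\<in>Om. p (x, y)) = P x" if x: "x \<in> Om" for x
  proof -
    have "(\<Sum>y\<in>Om. p (x, y)) = (\<Sum>y\<in>Om. if f y = f x then P x * Q y / M (f x) else 0)"
      using x by (intro sum.cong) (auto simp: p_def)
    also have "\<dots> = (\<Sum>y\<in>{y\<in>Om. f y = f x}. P x * Q y / M (f x))"
      using fin by (simp add: sum.inter_filter)
    also have "\<dots> = P x * M (f x) / M (f x)"
      by (simp add: MQ sum_distrib_left sum_divide_distrib)
    finally show ?thesis using PM[OF x] by simp
  qed
  moreover have "(\<Sum>x\<in>Om. p (x, y)) = Q y" if y: "y \<in> Om" for y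
  proof -
    have "(\<Sum>x\<in>Om. p (x, y)) = (\<Sum>x\<in>Om. if f x = f y then P x * Q y / M (f y) else 0)"
      using y by (intro sum.cong) (auto simp: p_def)
    also have "\<dots> = (\<Sum>x\<in>{x\<in>Om. f x = f y}. P x * Q y / M (f y))"
      using fin by (simp add: sum.inter_filter)
    also have "\<dots> = Q y * M (f y) / M (f y)"
      by (simp add: M_def sum_distrib_left sum_divide_distrib mult.commute)
    finally show ?thesis using QM[OF y] by simp
  qed
  ultimately have "is_coupling Om p P Q"
    unfolding is_coupling_def using P Q M0 by (auto simp: p_def)
  moreover have "(\<Sum>x\<in>Om. \<Sum>y\<in>Om. p (x, y) * c x y) \<le> 0"
  proof (intro sum_nonpos)
    fix x y assume "x \<in> Om" "y \<in> Om"
    then show "p (x, y) * c x y \<le> 0"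
      using P Q M0 c by (auto simp: p_def intro!: mult_nonneg_nonpos simp del: times_divide_eq_left)
  qed
  ultimately show ?thesis unfolding transport_le_def by blast
qed

text \<open>A pair of positive coupling mass lies in both supports; this is how pinnings read off
  from a coupling are known to be feasible.\<close>

lemma is_coupling_zero:
  assumes "finite Om" "is_coupling Om p P Q" "x \<in> Om" "y \<in> Om"
  shows "P x = 0 \<Longrightarrow> p (x, y) = 0" and "Q y = 0 \<Longrightarrow> p (x, y) = 0"
proof -
  have nn: "\<And>z. p z \<ge> 0" using assms(2) unfolding is_coupling_def by blast
  show "p (x, y) = 0" if "P x = 0"
  proof -
    have "(\<Sum>y\<in>Om. p (x, y)) = 0" using that assms unfolding is_coupling_def by auto
    then show ?thesis using assms nn by (subst (asm) sum_nonneg_eq_0_iff) auto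
  qed
  show "p (x, y) = 0" if "Q y = 0"
  proof -
    have "(\<Sum>x\<in>Om. p (x, y)) = 0" using that assms unfolding is_coupling_def by auto
    then show ?thesis using assms nn by (subst (asm) sum_nonneg_eq_0_iff) auto
  qed
qed

text \<open>Gluing: \<open>r x y z\<close> has the two couplings as its marginals on
  \<open>(x, y)\<close> and \<open>(y, z)\<close> and makes \<open>x\<close> and \<open>z\<close>
  conditionally independent given \<open>y\<close>. Its marginal on \<open>(x, z)\<close> is the
  coupling sought.\<close>

lemma transport_le_trans:
  assumes fin: "finite Om"
    and PQ: "transport_le Om c P Q k" and QT: "transport_le Om c Q T k'"
    and tri: "\<And>x y z. c x z \<le> c x y + c y z"
  shows "transport_le Om c P T (k + k')"
proof -
  obtain p where p: "is_coupling Om p P Q" "(\<Sum>x\<in>Om. \<Sum>y\<in>Om. p (x, y) * c x y) \<le> k"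
    using PQ unfolding transport_le_def by blast
  obtain p' where p': "is_coupling Om p' Q T" "(\<Sum>x\<in>Om. \<Sum>y\<in>Om. p' (x, y) * c x y) \<le> k'"
    using QT unfolding transport_le_def by blast
  have pnn: "\<And>z. p z \<ge> 0" and pnn': "\<And>z. p' z \<ge> 0"
    and pQ: "\<And>y. y \<in> Om \<Longrightarrow> (\<Sum>x\<in>Om. p (x, y)) = Q y"
    and pQ': "\<And>y. y \<in> Om \<Longrightarrow> (\<Sum>z\<in>Om. p' (y, z)) = Q y"
    using p(1) p'(1) unfolding is_coupling_def by auto
  have Qnn: "Q y \<ge> 0" if "y \<in> Om" for y using pQ[OF that] pnn by (metis sum_nonneg)
  define r where "r x y z = p (x, y) * p' (y, z) / Q y" for x y z
  have rnn: "r x y z \<ge> 0" if "y \<in> Om" for x y z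
    using pnn pnn' Qnn[OF that] by (simp add: r_def)
  have rz: "(\<Sum>z\<in>Om. r x y z) = p (x, y)" if "x \<in> Om" "y \<in> Om" for x y
  proof -
    have "(\<Sum>z\<in>Om. r x y z) = p (x, y) * Q y / Q y"
      unfolding r_def pQ'[OF that(2), symmetric] by (simp add: sum_distrib_left sum_divide_distrib)
    then show ?thesis using is_coupling_zero(2)[OF fin p(1) that] by (cases "Q y = 0") auto
  qed
  have rx: "(\<Sum>x\<in>Om. r x y z) = p' (y, z)" if "y \<in> Om" "z \<in> Om" for y z
  proof -
    have "(\<Sum>x\<in>Om. r x y z) = Q y * p' (y, z) / Q y"
      unfolding r_def pQ[OF that(1), symmetric] by (simp add: sum_distrib_right sum_divide_distrib)
    then show ?thesis using is_coupling_zero(1)[OF fin p'(1) that] by (cases "Q y = 0") auto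
  qed
  define s where "s w = (if w \<in> Om \<times> Om then \<Sum>y\<in>Om. r (fst w) y (snd w) else 0)" for w
  have "(\<Sum>z\<in>Om. s (x, z)) = P x" if x: "x \<in> Om" for x
  proof -
    have "(\<Sum>z\<in>Om. s (x, z)) = (\<Sum>z\<in>Om. \<Sum>y\<in>Om. r x y z)" using x by (simp add: s_def)
    also have "\<dots> = (\<Sum>y\<in>Om. p (x, y))" using x rz by (subst sum.swap) simp
    finally show ?thesis using p(1) x unfolding is_coupling_def by auto
  qed
  moreover have "(\<Sum>x\<in>Om. s (x, z)) = T z" if z: "z \<in> Om" for z
  proof -
    have "(\<Sum>x\<in>Om. s (x, z)) = (\<Sum>x\<in>Om. \<Sum>y\<in>Om. r x y z)" using z by (simp add: s_def)
    also have "\<dots> = (\<Sum>y\<in>Om. p' (y, z))" using z rx by (subst sum.swap) simp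
    finally show ?thesis using p'(1) z unfolding is_coupling_def by auto
  qed
  ultimately have "is_coupling Om s P T"
    unfolding is_coupling_def using rnn by (auto simp: s_def intro!: sum_nonneg)
  moreover have "(\<Sum>x\<in>Om. \<Sum>z\<in>Om. s (x, z) * c x z) \<le> k + k'"
  proof -
    have "(\<Sum>x\<in>Om. \<Sum>z\<in>Om. s (x, z) * c x z) = (\<Sum>x\<in>Om. \<Sum>z\<in>Om. \<Sum>y\<in>Om. r x y z * c x z)"
      by (simp add: s_def sum_distrib_right)
    also have "\<dots> \<le> (\<Sum>x\<in>Om. \<Sum>z\<in>Om. \<Sum>y\<in>Om. r x y z * c x y + r x y z * c y z)"
      using rnn tri by (intro sum_mono) (simp add: distrib_left[symmetric] mult_left_mono)
    also have "\<dots> = (\<Sum>x\<in>Om. \<Sum>z\<in>Om. \<Sum>y\<in>Om. r x y z * c x y)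
                   + (\<Sum>x\<in>Om. \<Sum>z\<in>Om. \<Sum>y\<in>Om. r x y z * c y z)"
      by (simp add: sum.distrib)
    also have "(\<Sum>x\<in>Om. \<Sum>z\<in>Om. \<Sum>y\<in>Om. r x y z * c x y)
             = (\<Sum>x\<in>Om. \<Sum>y\<in>Om. (\<Sum>z\<in>Om. r x y z) * c x y)"
      unfolding sum_distrib_right by (rule sum.cong[OF refl]) (rule sum.swap)
    also have "\<dots> = (\<Sum>x\<in>Om. \<Sum>y\<in>Om. p (x, y) * c x y)" by (simp add: rz)
    also have "(\<Sum>x\<in>Om. \<Sum>z\<in>Om. \<Sum>y\<in>Om. r x y z * c y z)
             = (\<Sum>z\<in>Om. \<Sum>x\<in>Om. \<Sum>y\<in>Om. r x y z * c y z)"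
      by (rule sum.swap)
    also have "\<dots> = (\<Sum>z\<in>Om. \<Sum>y\<in>Om. (\<Sum>x\<in>Om. r x y z) * c y z)"
      unfolding sum_distrib_right by (rule sum.cong[OF refl]) (rule sum.swap)
    also have "\<dots> = (\<Sum>y\<in>Om. \<Sum>z\<in>Om. p' (y, z) * c y z)" by (subst sum.swap) (simp add: rx)
    finally show ?thesis using p(2) p'(2) by linarith
  qed
  ultimately show ?thesis unfolding transport_le_def by blast
qed

text \<open>Averaging couplings with the weights \<open>l i\<close> couples the averages, at the
  averaged cost. A coupling is asked for only where \<open>l i > 0\<close>, since an index of weight
  zero may stand for an infeasible pinning.\<close>

lemma transport_le_mixture:
  assumes I: "finite I" and l0: "\<And>i. i \<in> I \<Longrightarrow> l i \<ge> 0"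
    and tr: "\<And>i. i \<in> I \<Longrightarrow> l i > 0 \<Longrightarrow> transport_le Om c (P' i) (Q' i) (k i)"
    and P: "\<And>x. x \<in> Om \<Longrightarrow> P x = (\<Sum>i\<in>I. l i * P' i x)"
    and Q: "\<And>x. x \<in> Om \<Longrightarrow> Q x = (\<Sum>i\<in>I. l i * Q' i x)"
  shows "transport_le Om c P Q (\<Sum>i\<in>I. l i * k i)"
proof -
  have "\<forall>i. \<exists>p. i \<in> I \<longrightarrow> l i > 0 \<longrightarrow> is_coupling Om p (P' i) (Q' i)
           \<and> (\<Sum>x\<in>Om. \<Sum>y\<in>Om. p (x, y) * c x y) \<le> k i"
    using tr unfolding transport_le_def by blast
  from choice[OF this] obtain p where
    p: "\<And>i. i \<in> I \<Longrightarrow> l i > 0 \<Longrightarrow> is_coupling Om (p i) (P' i) (Q' i)"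
    "\<And>i. i \<in> I \<Longrightarrow> l i > 0 \<Longrightarrow> (\<Sum>x\<in>Om. \<Sum>y\<in>Om. p i (x, y) * c x y) \<le> k i"
    by blast
  define s where "s z = (\<Sum>i\<in>I. l i * p i z)" for z
  have pos: "i \<in> I \<Longrightarrow> l i = 0 \<or> l i > 0" for i using l0[of i] by auto
  have "s z \<ge> 0" for z unfolding s_def
  proof (intro sum_nonneg)
    fix i assume "i \<in> I"
    then show "0 \<le> l i * p i z"
      using pos[of i] p(1)[of i] by (cases z) (auto simp: is_coupling_def)
  qed
  moreover have "s z = 0" if "z \<notin> Om \<times> Om" for z unfolding s_def
  proof (intro sum.neutral ballI)
    fix i assume "i \<in> I"
    then show "l i * p i z = 0"
      using pos[of i] p(1)[of i] that by (cases z) (auto simp: is_coupling_def)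
  qed
  moreover have "(\<Sum>y\<in>Om. s (x, y)) = P x" if x: "x \<in> Om" for x
  proof -
    have "(\<Sum>y\<in>Om. s (x, y)) = (\<Sum>i\<in>I. l i * (\<Sum>y\<in>Om. p i (x, y)))"
      unfolding s_def by (subst sum.swap) (simp add: sum_distrib_left)
    also have "\<dots> = (\<Sum>i\<in>I. l i * P' i x)"
    proof (intro sum.cong refl)
      fix i assume "i \<in> I"
      then show "l i * (\<Sum>y\<in>Om. p i (x, y)) = l i * P' i x"
        using pos[of i] p(1)[of i] x by (auto simp: is_coupling_def)
    qed
    finally show ?thesis using P[OF x] by simp
  qed
  moreover have "(\<Sum>x\<in>Om. s (x, y)) = Q y" if y: "y \<in> Om" for y
  proof -
    have "(\<Sum>x\<in>Om. s (x, y)) = (\<Sum>i\<in>I. l i * (\<Sum>x\<in>Om. p i (x, y)))"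
      unfolding s_def by (subst sum.swap) (simp add: sum_distrib_left)
    also have "\<dots> = (\<Sum>i\<in>I. l i * Q' i y)"
    proof (intro sum.cong refl)
      fix i assume "i \<in> I"
      then show "l i * (\<Sum>x\<in>Om. p i (x, y)) = l i * Q' i y"
        using pos[of i] p(1)[of i] y by (auto simp: is_coupling_def)
    qed
    finally show ?thesis using Q[OF y] by simp
  qed
  moreover have "(\<Sum>x\<in>Om. \<Sum>y\<in>Om. s (x, y) * c x y) \<le> (\<Sum>i\<in>I. l i * k i)"
  proof -
    have "(\<Sum>x\<in>Om. \<Sum>y\<in>Om. s (x, y) * c x y)
        = (\<Sum>x\<in>Om. \<Sum>y\<in>Om. \<Sum>i\<in>I. l i * (p i (x, y) * c x y))"
      by (simp add: s_def sum_distrib_right mult.assoc)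
    also have "\<dots> = (\<Sum>x\<in>Om. \<Sum>i\<in>I. \<Sum>y\<in>Om. l i * (p i (x, y) * c x y))"
      by (rule sum.cong[OF refl]) (rule sum.swap)
    also have "\<dots> = (\<Sum>i\<in>I. l i * (\<Sum>x\<in>Om. \<Sum>y\<in>Om. p i (x, y) * c x y))"
      by (subst sum.swap) (simp add: sum_distrib_left)
    also have "\<dots> \<le> (\<Sum>i\<in>I. l i * k i)"
    proof (intro sum_mono)
      fix i assume "i \<in> I"
      then show "l i * (\<Sum>x\<in>Om. \<Sum>y\<in>Om. p i (x, y) * c x y) \<le> l i * k i"
        using pos[of i] p(2)[of i] by auto
    qed
    finally show ?thesis .
  qed
  ultimately show ?thesis unfolding transport_le_def is_coupling_def by (intro exI[of _ s]) blast
qed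

section \<open>Hamming distance as a cost\<close>

definition hamming :: "'v set \<Rightarrow> ('v \<Rightarrow> 'b) \<Rightarrow> ('v \<Rightarrow> 'b) \<Rightarrow> real" where
  "hamming U x y = real (card {u\<in>U. x u \<noteq> y u})"

lemma hamming_commute: "hamming U x y = hamming U y x"
  by (simp add: hamming_def eq_commute)

lemma hamming_triangle:
  assumes "finite U"
  shows "hamming U x z \<le> hamming U x y + hamming U y z"
proof -
  have "card {u\<in>U. x u \<noteq> z u} \<le> card ({u\<in>U. x u \<noteq> y u} \<union> {u\<in>U. y u \<noteq> z u})"
    using assms by (intro card_mono) auto
  also have "\<dots> \<le> card {u\<in>U. x u \<noteq> y u} + card {u\<in>U. y u \<noteq> z u}" by (rule card_Un_le)
  finally show ?thesis by (simp add: hamming_def)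
qed

lemma hamming_mono: "finite U \<Longrightarrow> U' \<subseteq> U \<Longrightarrow> hamming U' x y \<le> hamming U x y"
  by (auto simp: hamming_def intro!: card_mono)

lemma hamming_eq_sum:
  "finite U \<Longrightarrow> hamming U x y = (\<Sum>u\<in>U. if x u \<noteq> y u then 1 else 0)"
  by (simp add: hamming_def sum.inter_filter[symmetric])

lemma exp_disagree_eq:
  "exp_disagree Om p S = (\<Sum>x\<in>Om. \<Sum>y\<in>Om. p (x, y) * hamming S x y)"
  by (simp add: exp_disagree_def hamming_def sum.cartesian_product)

lemma transport_le_hamming_iff:
  "transport_le Om (hamming U) P Q k \<longleftrightarrow> (\<exists>p. is_coupling Om p P Q \<and> exp_disagree Om p U \<le> k)"
  by (simp add: transport_le_def exp_disagree_eq)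

section \<open>Pinned Gibbs measures\<close>

locale gibbs_system =
  fixes q :: nat and V :: "'v set" and Ed :: "('v \<times> 'v) set"
    and Aedge :: "nat \<Rightarrow> nat \<Rightarrow> real" and Avert :: "nat \<Rightarrow> real"
  assumes sys: "spin_system q V Ed Aedge Avert"
begin

abbreviation "Om \<equiv> configs q V"
abbreviation "wt \<equiv> pin_weight V Ed Aedge Avert"
abbreviation "Z \<equiv> pin_Z q V Ed Aedge Avert"
abbreviation "G \<equiv> gibbs_pin q V Ed Aedge Avert"

lemma finite_V: "finite V" and Ed_subset: "Ed \<subseteq> V \<times> V"
  using sys by (auto simp: spin_system_def simple_graph_def)

lemma finite_Ed: "finite Ed"
  using finite_V Ed_subset by (meson finite_SigmaI finite_subset)

lemma finite_Om: "finite Om"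
  using finite_V by (simp add: configs_def finite_PiE)

lemma Om_less: "x \<in> Om \<Longrightarrow> u \<in> V \<Longrightarrow> x u < q"
  by (auto simp: configs_def)

lemma wt_nonneg: "x \<in> Om \<Longrightarrow> wt A s x \<ge> 0"
  using sys Ed_subset Om_less
  by (auto simp: pin_weight_def spin_system_def intro!: mult_nonneg_nonneg prod_nonneg)

lemma wt_cong: "(\<And>w. w \<in> A \<Longrightarrow> s w = t w) \<Longrightarrow> wt A s x = wt A t x"
  by (simp add: pin_weight_def)

lemma Z_cong: "(\<And>w. w \<in> A \<Longrightarrow> s w = t w) \<Longrightarrow> Z A s = Z A t"
  unfolding pin_Z_def by (intro sum.cong refl wt_cong)

lemma G_cong:
  assumes "\<And>w. w \<in> A \<Longrightarrow> s w = t w"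
  shows "G A s = G A t"
  using wt_cong[OF assms] Z_cong[OF assms] by (intro ext) (simp add: gibbs_pin_def)

lemma wt_agree: "wt A s x \<noteq> 0 \<Longrightarrow> w \<in> A \<Longrightarrow> x w = s w"
  by (auto simp: pin_weight_def split: if_splits)

section \<open>Conditioning on a larger pinned set\<close>

text \<open>The factor \<open>k\<close> collects the vertex factors on \<open>B - A\<close> and the
  factors of the edges inside \<open>B\<close> but not inside \<open>A\<close>. These see only the
  values of \<open>x\<close> on \<open>B\<close>, so one \<open>k\<close> serves every
  \<open>s\<close> and \<open>y\<close>.\<close>

lemma wt_split:
  assumes AB: "A \<subseteq> B" "B \<subseteq> V"
  obtains k where "\<And>s y. (\<And>w. w \<in> A \<Longrightarrow> y w = s w) \<Longrightarrow> (\<And>w. w \<in> B \<Longrightarrow> y w = x w)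
                     \<Longrightarrow> wt A s y = k * wt B x y"
proof
  let ?E1 = "{e\<in>Ed. (fst e \<in> B \<and> snd e \<in> B) \<and> \<not> (fst e \<in> A \<and> snd e \<in> A)}"
  let ?E2 = "{e\<in>Ed. \<not> (fst e \<in> B \<and> snd e \<in> B)}"
  fix s y assume yA: "\<And>w. w \<in> A \<Longrightarrow> y w = s w" and yB: "\<And>w. w \<in> B \<Longrightarrow> y w = x w"
  have "V - A = (B - A) \<union> (V - B)" using AB by auto
  then have v: "(\<Prod>w\<in>V - A. Avert (y w)) = (\<Prod>w\<in>B - A. Avert (y w)) * (\<Prod>w\<in>V - B. Avert (y w))"
    using finite_V finite_subset[OF AB(2)] by (simp add: prod.union_disjoint Int_def)
  have "{e\<in>Ed. \<not> (fst e \<in> A \<and> snd e \<in> A)} = ?E1 \<union> ?E2" using AB by auto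
  then have e: "(\<Prod>e\<in>{e\<in>Ed. \<not> (fst e \<in> A \<and> snd e \<in> A)}. Aedge (y (fst e)) (y (snd e)))
      = (\<Prod>e\<in>?E1. Aedge (y (fst e)) (y (snd e))) * (\<Prod>e\<in>?E2. Aedge (y (fst e)) (y (snd e)))"
    using finite_Ed by (simp only:) (rule prod.union_disjoint, auto)
  have "(\<Prod>w\<in>B - A. Avert (y w)) = (\<Prod>w\<in>B - A. Avert (x w))"
    "(\<Prod>e\<in>?E1. Aedge (y (fst e)) (y (snd e))) = (\<Prod>e\<in>?E1. Aedge (x (fst e)) (x (snd e)))"
    using yB by (auto intro!: prod.cong)
  then show "wt A s y = ((\<Prod>w\<in>B - A. Avert (x w)) * (\<Prod>e\<in>?E1. Aedge (x (fst e)) (x (snd e)))) * wt B x y"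
    using yA yB unfolding pin_weight_def v e by simp
qed

text \<open>Take \<open>y = x\<close> in \<open>wt_split\<close>: a positive product has no zero
  factor. Hence values read off from a configuration of positive weight can be pinned in addition
  without losing feasibility.\<close>

lemma wt_pos_mono:
  assumes "A \<subseteq> B" "B \<subseteq> V" "x \<in> Om" "wt A s x > 0"
  shows "wt B x x > 0"
proof -
  obtain k where "\<And>s y. (\<And>w. w \<in> A \<Longrightarrow> y w = s w) \<Longrightarrow> (\<And>w. w \<in> B \<Longrightarrow> y w = x w)
                     \<Longrightarrow> wt A s y = k * wt B x y"
    using wt_split[OF assms(1,2)] by blast
  then have "wt A s x = k * wt B x x" using wt_agree[of A s x] assms(4) by simp
  then show ?thesis using wt_nonneg[OF assms(3), of B x] assms(4)
    by (metis less_eq_real_def mult_zero_right)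
qed

lemma Z_pos: "x \<in> Om \<Longrightarrow> wt A s x > 0 \<Longrightarrow> Z A s > 0"
  unfolding pin_Z_def using finite_Om wt_nonneg by (intro sum_pos2[of _ x]) auto

lemma Z_nonneg: "Z A s \<ge> 0"
  unfolding pin_Z_def using wt_nonneg by (intro sum_nonneg)

lemma G_nonneg: "G A s x \<ge> 0"
  using wt_nonneg Z_nonneg by (simp add: gibbs_pin_def)

lemma G_pos: "G A s x > 0 \<Longrightarrow> x \<in> Om \<and> wt A s x > 0"
  using wt_nonneg[of x A s] by (cases "wt A s x = 0") (auto simp: gibbs_pin_def split: if_splits)

lemma sum_G: "Z A s > 0 \<Longrightarrow> (\<Sum>x\<in>Om. G A s x) = 1"
  by (simp add: gibbs_pin_def pin_Z_def sum_divide_distrib[symmetric])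

text \<open>Drawing \<open>x\<close> and then resampling everything outside \<open>B\<close> given
  \<open>x\<close> on \<open>B\<close> preserves the measure. Only those \<open>x\<close> that agree
  with \<open>y\<close> on \<open>B\<close> contribute, and their total weight \<open>N y\<close>
  cancels the denominator left by the resampling.\<close>

lemma G_tower:
  assumes AB: "A \<subseteq> B" "B \<subseteq> V" and y: "y \<in> Om"
  shows "G A s y = (\<Sum>x\<in>Om. G A s x * G B x y)"
proof -
  define ag where "ag x y \<longleftrightarrow> (\<forall>w\<in>B. y w = x w)" for x y :: "'v \<Rightarrow> nat"
  define N where "N x = (\<Sum>y\<in>{y\<in>Om. ag x y}. wt A s y)" for x
  have Ncong: "N x = N y" if "ag x y" for x y
    using that by (simp add: N_def ag_def)
  have *: "G A s x * G B x y = (if ag y x then wt A s x else 0) * (wt A s y / N y / Z A s)"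
    if x: "x \<in> Om" for x
  proof (cases "wt A s x = 0")
    case True
    then show ?thesis by (simp add: gibbs_pin_def)
  next
    case False
    obtain k where k: "\<And>s y. (\<And>w. w \<in> A \<Longrightarrow> y w = s w) \<Longrightarrow> (\<And>w. w \<in> B \<Longrightarrow> y w = x w)
                     \<Longrightarrow> wt A s y = k * wt B x y"
      using wt_split[OF AB] by blast
    have xs: "w \<in> A \<Longrightarrow> x w = s w" for w using wt_agree False by blast
    have kk: "(if ag x z then wt A s z else 0) = k * wt B x z" for z
    proof (cases "ag x z")
      case True
      then have "z w = s w" if "w \<in> A" for w using xs[OF that] that AB(1) by (auto simp: ag_def)
      then show ?thesis using k[of z s] True unfolding ag_def by simp
    next
      case False
      then show ?thesis by (auto simp: ag_def pin_weight_def)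
    qed
    \<comment> \<open>For \<open>z = x\<close> the identity reads
      \<open>wt A s x = k * wt B x x\<close>, with nonzero left side in this case; so
      \<open>k\<close> cancels between weight and normaliser.\<close>
    have k0: "k \<noteq> 0" using kk[of x] False by (auto simp: ag_def)
    have "N x = (\<Sum>z\<in>Om. if ag x z then wt A s z else 0)"
      unfolding N_def using finite_Om by (simp add: sum.inter_filter)
    also have "\<dots> = k * Z B x" by (simp add: kk pin_Z_def sum_distrib_left)
    finally have Nx: "N x = k * Z B x" .
    have "G B x y = k * wt B x y / (k * Z B x)" using y k0 by (simp add: gibbs_pin_def)
    also have "\<dots> = (if ag x y then wt A s y else 0) / N x" by (simp add: kk Nx)
    also have "\<dots> = (if ag x y then wt A s y / N y else 0)" using Ncong by auto
    finally have "G B x y = (if ag y x then wt A s y / N y else 0)" by (auto simp: ag_def)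
    then show ?thesis using x by (simp add: gibbs_pin_def)
  qed
  have "(\<Sum>x\<in>Om. G A s x * G B x y) = (\<Sum>x\<in>Om. if ag y x then wt A s x else 0) * (wt A s y / N y / Z A s)"
    unfolding sum_distrib_right by (intro sum.cong refl) (rule *)
  also have "(\<Sum>x\<in>Om. if ag y x then wt A s x else 0) = N y"
    unfolding N_def using finite_Om by (simp add: sum.inter_filter)
  also have "N y * (wt A s y / N y / Z A s) = wt A s y / Z A s"
  proof (cases "N y = 0")
    case True
    then have "wt A s y = 0" unfolding N_def using finite_Om wt_nonneg y
      by (subst (asm) sum_nonneg_eq_0_iff) (auto simp: ag_def)
    then show ?thesis by simp
  qed simp
  finally show ?thesis using y by (simp add: gibbs_pin_def)
qed

section \<open>Pairs of pinnings that differ at one vertex\<close>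

text \<open>Only values on \<open>A\<close> are constrained, so that whole configurations, such as
  two drawn from a coupling, can serve as pinnings directly.\<close>

definition pin_pair :: "'v set \<Rightarrow> ('v \<Rightarrow> nat) \<Rightarrow> ('v \<Rightarrow> nat) \<Rightarrow> 'v \<Rightarrow> bool" where
  "pin_pair A s t v \<longleftrightarrow> A \<subseteq> V \<and> v \<in> A \<and> (\<forall>w\<in>A. s w < q \<and> t w < q) \<and> s v \<noteq> t v
     \<and> (\<forall>w\<in>A - {v}. s w = t w) \<and> Z A s > 0 \<and> Z A t > 0"

text \<open>Uniformity over the pinned set and its values lets one bound be used for all the
  intermediate pinnings of a recoupling.\<close>

definition pair_bound :: "'v \<Rightarrow> 'v set \<Rightarrow> real \<Rightarrow> bool" where
  "pair_bound v U k \<longleftrightarrow>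
     (\<forall>A s t. pin_pair A s t v \<longrightarrow> transport_le Om (hamming U) (G A s) (G A t) k)"

lemma pair_bound_mono:
  assumes "pair_bound v U k" "finite U" "U' \<subseteq> U" "k \<le> k'"
  shows "pair_bound v U' k'"
  using assms(1) unfolding pair_bound_def
  by (meson transport_le_mono[OF _ assms(4)] hamming_mono[OF assms(2,3)])

lemma transport_le_G_refl: "transport_le Om (hamming U) (G A s) (G A s) 0"
  using finite_Om G_nonneg
  by (intro transport_le_fibres[where f = id]) (auto simp: hamming_def)

text \<open>Unpinning \<open>u\<close> is averaging over its spin: \<open>G A x\<close> is the
  mixture, over \<open>y\<close> drawn from it, of the measures with \<open>u\<close> also pinned to
  \<open>y u\<close>. Each of these equals \<open>G (insert u A) x\<close> or forms with it a
  feasible pair that differs at \<open>u\<close> alone.\<close>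

lemma unpin_vertex:
  assumes x: "x \<in> Om" "wt A x x > 0" and A: "insert u A \<subseteq> V"
    and bd: "pair_bound u U B" "B \<ge> 0"
  shows "transport_le Om (hamming U) (G (insert u A) x) (G A x) B"
proof -
  let ?A = "insert u A"
  have ZA: "Z A x > 0" using Z_pos x by blast
  have "transport_le Om (hamming U) (G ?A x) (G A x) (\<Sum>y\<in>Om. G A x y * B)"
  proof (rule transport_le_mixture[where P' = "\<lambda>_. G ?A x" and Q' = "\<lambda>y. G ?A y"])
    show "finite Om" by (rule finite_Om)
    show "0 \<le> G A x y" for y by (rule G_nonneg)
    show "G ?A x z = (\<Sum>y\<in>Om. G A x y * G ?A x z)" for z
      by (simp add: sum_distrib_right[symmetric] sum_G[OF ZA])
    show "G A x z = (\<Sum>y\<in>Om. G A x y * G ?A y z)" if "z \<in> Om" for z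
      using G_tower[OF _ A that] by blast
    fix y assume y: "y \<in> Om" "0 < G A x y"
    have wy: "wt A x y > 0" using G_pos y by blast
    then have ag: "w \<in> A \<Longrightarrow> y w = x w" for w using wt_agree[of A x y w] by auto
    show "transport_le Om (hamming U) (G ?A x) (G ?A y) B"
    proof (cases "y u = x u")
      case True
      then have "G ?A y = G ?A x" using ag by (intro G_cong) auto
      then show ?thesis using transport_le_mono[OF transport_le_G_refl bd(2)] by auto
    next
      case False
      have "wt ?A x x > 0" "wt ?A y y > 0"
        using wt_pos_mono[OF subset_insertI A] x y(1) wy by blast+
      then have "Z ?A x > 0" "Z ?A y > 0" using Z_pos x(1) y(1) by blast+
      then have "pin_pair ?A x y u"
        using False A ag Om_less x(1) y(1) unfolding pin_pair_def by auto
      then show ?thesis using bd(1) unfolding pair_bound_def by blast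
    qed
  qed
  then show ?thesis by (simp add: sum_distrib_right[symmetric] sum_G[OF ZA])
qed

text \<open>All intermediate pinnings are restrictions of the one configuration \<open>x\<close>,
  hence feasible, and the costs add up by the triangle inequality.\<close>

lemma unpin_set:
  assumes x: "x \<in> Om" "wt A x x > 0" and U: "finite U" and B: "B \<ge> 0"
    and D: "finite D" "A \<union> D \<subseteq> V"
    and bd: "\<And>u. u \<in> D \<Longrightarrow> pair_bound u U B"
  shows "transport_le Om (hamming U) (G (A \<union> D) x) (G A x) (real (card D) * B)"
  using D bd
proof (induction D rule: finite_induct)
  case empty
  then show ?case using transport_le_G_refl by simp
next
  case (insert u D)
  have IH: "transport_le Om (hamming U) (G (A \<union> D) x) (G A x) (real (card D) * B)"
    using insert by auto
  have "wt (A \<union> D) x x > 0" using wt_pos_mono[of A "A \<union> D"] x insert.prems by auto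
  then have "transport_le Om (hamming U) (G (insert u (A \<union> D)) x) (G (A \<union> D) x) B"
    using unpin_vertex[of x "A \<union> D" u U B] x insert.prems B by auto
  from transport_le_trans[OF finite_Om this IH hamming_triangle[OF U]]
  show ?case using insert.hyps by (simp add: algebra_simps)
qed

text \<open>Exchanging the parts of two configurations on \<open>O'\<close> preserves the product of their weights;
  summing over the second configuration gives equality of the two marginals on \<open>O'\<close>.\<close>

lemma transport_le_screened:
  assumes SA: "S \<subseteq> A"
    and edge: "\<And>a b. (a, b) \<in> Ed \<Longrightarrow> (a \<in> O' \<longrightarrow> b \<in> O' \<union> S) \<and> (b \<in> O' \<longrightarrow> a \<in> O' \<union> S)"
    and OV: "O' \<subseteq> V"
    and st: "\<And>w. w \<in> A \<inter> (O' \<union> S) \<Longrightarrow> s w = t w"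
    and Zs: "Z A s > 0" and Zt: "Z A t > 0"
  shows "transport_le Om (hamming O') (G A s) (G A t) 0"
proof (rule transport_le_fibres[where f = "\<lambda>x. restrict x O'"])
  define sw :: "('v \<Rightarrow> nat) \<Rightarrow> ('v \<Rightarrow> nat) \<Rightarrow> 'v \<Rightarrow> nat"
    where "sw x y = (\<lambda>w. if w \<in> O' then y w else x w)" for x y
  define ag where "ag x s \<longleftrightarrow> (\<forall>w\<in>A. x w = s w)" for x s :: "'v \<Rightarrow> nat"
  have swsw: "sw (sw x y) (sw y x) = x" for x y by (auto simp: sw_def)
  have agsw: "ag (sw x y) s" "ag (sw y x) t" if "ag x s" "ag y t" for x y
    using that st by (auto simp: ag_def sw_def)
  have ex: "wt A s x * wt A t y = wt A s (sw x y) * wt A t (sw y x)" for x y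
  proof (cases "ag x s \<and> ag y t")
    case False
    then have "\<not> (ag (sw x y) s \<and> ag (sw y x) t)"
      using agsw[of "sw x y" "sw y x"] swsw by auto
    then show ?thesis using False unfolding pin_weight_def ag_def by auto
  next
    case True
    have v: "(\<Prod>w\<in>V - A. Avert (x w)) * (\<Prod>w\<in>V - A. Avert (y w))
        = (\<Prod>w\<in>V - A. Avert (sw x y w)) * (\<Prod>w\<in>V - A. Avert (sw y x w))"
      unfolding prod.distrib[symmetric] by (intro prod.cong) (auto simp: sw_def)
    let ?E = "{e\<in>Ed. \<not> (fst e \<in> A \<and> snd e \<in> A)}"
    have e: "(\<Prod>e\<in>?E. Aedge (x (fst e)) (x (snd e))) * (\<Prod>e\<in>?E. Aedge (y (fst e)) (y (snd e)))
        = (\<Prod>e\<in>?E. Aedge (sw x y (fst e)) (sw x y (snd e)))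
          * (\<Prod>e\<in>?E. Aedge (sw y x (fst e)) (sw y x (snd e)))"
      unfolding prod.distrib[symmetric]
    proof (intro prod.cong refl)
      fix e assume "e \<in> ?E"
      then obtain a b where ab: "e = (a, b)" "(a, b) \<in> Ed" by (cases e) auto
      \<comment> \<open>An edge that leaves \<open>O'\<close> ends in \<open>S\<close>, where
        \<open>x\<close> and \<open>y\<close> agree, so the exchange at most swaps the two edge
        factors.\<close>
      have S: "w \<in> S \<Longrightarrow> x w = y w" for w using True SA st[of w] by (auto simp: ag_def)
      show "Aedge (x (fst e)) (x (snd e)) * Aedge (y (fst e)) (y (snd e))
          = Aedge (sw x y (fst e)) (sw x y (snd e)) * Aedge (sw y x (fst e)) (sw y x (snd e))"
        using edge[OF ab(2)] S[of a] S[of b] unfolding ab(1) sw_def by auto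
    qed
    have "wt A s x * wt A t y =
       ((\<Prod>w\<in>V - A. Avert (x w)) * (\<Prod>w\<in>V - A. Avert (y w))) *
       ((\<Prod>e\<in>?E. Aedge (x (fst e)) (x (snd e))) * (\<Prod>e\<in>?E. Aedge (y (fst e)) (y (snd e))))"
      using True by (simp add: pin_weight_def ag_def)
    also have "\<dots> = wt A s (sw x y) * wt A t (sw y x)"
      unfolding v e using agsw[of x y] True by (simp add: pin_weight_def ag_def)
    finally show ?thesis .
  qed
  have swOm: "sw x y \<in> Om" if "x \<in> Om" "y \<in> Om" for x y
    using that OV unfolding configs_def sw_def by (auto simp: PiE_iff extensional_def)
  fix b :: "'v \<Rightarrow> nat"
  let ?F = "{x\<in>Om. restrict x O' = b}"
  have rs: "restrict (sw x y) O' = restrict y O'" for x y by (auto simp: sw_def)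
  have "(\<Sum>x\<in>?F. wt A s x) * Z A t = (\<Sum>(x, y)\<in>?F \<times> Om. wt A s x * wt A t y)"
    by (simp add: pin_Z_def sum_product sum.cartesian_product)
  \<comment> \<open>The exchange is an involution on pairs that moves the condition on
    \<open>O'\<close> from the first component to the second.\<close>
  also have "\<dots> = (\<Sum>(x, y)\<in>Om \<times> ?F. wt A s x * wt A t y)"
    by (rule sum.reindex_bij_witness[where i = "\<lambda>(x, y). (sw x y, sw y x)"
          and j = "\<lambda>(x, y). (sw x y, sw y x)"])
       (auto simp: swsw swOm rs ex[symmetric])
  also have "\<dots> = Z A s * (\<Sum>y\<in>?F. wt A t y)"
    by (simp add: pin_Z_def sum_product sum.cartesian_product)
  finally have "(\<Sum>x\<in>?F. wt A s x) / Z A s = (\<Sum>x\<in>?F. wt A t x) / Z A t"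
    using Zs Zt by (simp add: field_simps)
  then show "(\<Sum>x\<in>?F. G A s x) = (\<Sum>x\<in>?F. G A t x)"
    by (simp add: gibbs_pin_def sum_divide_distrib)
next
  fix x y assume "restrict x O' = restrict y O'"
  then have "{u\<in>O'. x u \<noteq> y u} = {}" by (auto simp: restrict_def fun_eq_iff split: if_splits)
  then show "hamming O' x y \<le> 0" unfolding hamming_def by (simp only: card.empty)
qed (use finite_Om G_nonneg in auto)

end

section \<open>Recoupling at a sphere\<close>

context gibbs_system
begin

section \<open>Spheres and graph distance\<close>

abbreviation "sph \<equiv> graph_sphere Ed"

text \<open>Distance at least \<open>R\<close>, including the vertices that \<open>v\<close> cannot
  reach. So, for \<open>v\<close> in \<open>V\<close>, the spheres of radius below \<open>R\<close>
  and \<open>far v R\<close> partition \<open>V\<close>.\<close>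

definition far :: "'v \<Rightarrow> nat \<Rightarrow> 'v set" where
  "far v R = {u\<in>V. \<forall>k<R. (v, u) \<notin> adj_rel Ed ^^ k}"

lemma far_subset: "far v R \<subseteq> V" and finite_far: "finite (far v R)"
  using finite_V by (auto simp: far_def)

lemma far_antimono: "r \<le> R \<Longrightarrow> far v R \<subseteq> far v r"
  by (auto simp: far_def)

lemma far_0: "far v 0 = V"
  by (simp add: far_def)

lemma adj_rel_subset: "adj_rel Ed \<subseteq> V \<times> V"
  using Ed_subset by (auto simp: adj_rel_def)

lemma sph_0: "sph v 0 = {v}"
  by (auto simp: graph_sphere_def)

lemma sph_subset:
  assumes "v \<in> V"
  shows "sph v r \<subseteq> V"
proof (cases r)
  case 0
  then show ?thesis using assms by (simp add: sph_0)
next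
  case (Suc n)
  then show ?thesis using adj_rel_subset by (auto simp: graph_sphere_def)
qed

lemma finite_sph: "v \<in> V \<Longrightarrow> finite (sph v r)"
  using sph_subset finite_V finite_subset by blast

lemma sph_subset_far: "v \<in> V \<Longrightarrow> sph v r \<subseteq> far v r"
  using sph_subset by (auto simp: graph_sphere_def far_def)

lemma far_split:
  assumes "v \<in> V"
  shows "far v r = sph v r \<union> far v (Suc r)" "sph v r \<inter> far v (Suc r) = {}"
  using sph_subset[OF assms, of r] by (auto simp: far_def graph_sphere_def less_Suc_eq)

text \<open>Triangle inequality for the graph distance: a bound centred at a vertex of the sphere,
  with remaining radius \<open>R - r\<close>, applies on \<open>far v R\<close>.\<close>

lemma far_subset_far_sph:
  assumes "w \<in> sph v r"
  shows "far v R \<subseteq> far w (R - r)"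
proof
  fix u assume u: "u \<in> far v R"
  have "(w, u) \<notin> adj_rel Ed ^^ k" if "k < R - r" for k
  proof
    assume "(w, u) \<in> adj_rel Ed ^^ k"
    then have "(v, u) \<in> adj_rel Ed ^^ (r + k)"
      using assms unfolding graph_sphere_def relpow_add by auto
    then show False using u that by (auto simp: far_def)
  qed
  then show "u \<in> far w (R - r)" using u by (auto simp: far_def)
qed

text \<open>Distance drops by at most 1 along an edge, so the sphere of radius \<open>r\<close>
  screens what lies beyond it from what lies inside.\<close>

lemma adj_far:
  assumes "(a, b) \<in> adj_rel Ed" "a \<in> far v (Suc r)"
  shows "b \<in> far v (Suc r) \<union> sph v r"
proof -
  have ab: "(b, a) \<in> adj_rel Ed" using assms(1) by (auto simp: adj_rel_def)
  have bV: "b \<in> V" using assms(1) adj_rel_subset by auto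
  have "(v, b) \<notin> adj_rel Ed ^^ k" if "k < r" for k
  proof
    assume "(v, b) \<in> adj_rel Ed ^^ k"
    then have "(v, a) \<in> adj_rel Ed ^^ Suc k" using ab by auto
    then show False using assms(2) that unfolding far_def by blast
  qed
  then show ?thesis using bV by (auto simp: far_def graph_sphere_def less_Suc_eq)
qed

text \<open>Here \<open>B\<close> pays for unpinning or pinning one disagreement on the sphere and
  \<open>F\<close> for switching the spin of \<open>v\<close>. Since \<open>F\<close> concerns the
  same radius \<open>R\<close> as the conclusion, the lemma serves to improve a bound already known
  at \<open>R\<close>.\<close>

lemma recouple:
  assumes pair: "pin_pair L s t v" and r: "0 < r" "r < R"
    and p: "is_coupling Om p (G L s) (G L t)"
    and B: "\<And>w. pair_bound w (far w (R - r)) B" "B \<ge> 0"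
    and F: "pair_bound v (far v R) F" "F \<ge> 0"
  shows "transport_le Om (hamming (far v R)) (G L s) (G L t)
           (exp_disagree Om p (sph v r) * (2 * B + F))"
proof -
  let ?U = "far v R" and ?S = "sph v r"
  have LV: "L \<subseteq> V" and vL: "v \<in> L" and st: "\<And>w. w \<in> L \<Longrightarrow> w \<noteq> v \<Longrightarrow> s w = t w"
    using pair unfolding pin_pair_def by auto
  have vV: "v \<in> V" using LV vL by blast
  have SV: "?S \<subseteq> V" and finS: "finite ?S" using sph_subset finite_sph vV by auto
  \<comment> \<open>A positive radius keeps \<open>v\<close> off the sphere, so \<open>s\<close> and
    \<open>t\<close> agree on the part of \<open>L\<close> on or beyond it.\<close>
  have vS: "v \<notin> ?S" using r(1) by (auto simp: graph_sphere_def intro: exI[of _ 0])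
  have LSV: "L \<union> ?S \<subseteq> V" using LV SV by auto
  have p0: "\<And>z. p z \<ge> 0" using p unfolding is_coupling_def by blast
  have "transport_le Om (hamming ?U) (G L s) (G L t)
      (\<Sum>z\<in>Om \<times> Om. p z * (hamming ?S (fst z) (snd z) * (2 * B + F)))"
  proof (rule transport_le_mixture[where P' = "\<lambda>z. G (L \<union> ?S) (fst z)"
              and Q' = "\<lambda>z. G (L \<union> ?S) (snd z)"])
    show "finite (Om \<times> Om)" using finite_Om by simp
    show "0 \<le> p z" for z by (rule p0)
    show "G L s z = (\<Sum>i\<in>Om \<times> Om. p i * G (L \<union> ?S) (fst i) z)" if z: "z \<in> Om" for z
    proof -
      have "(\<Sum>i\<in>Om \<times> Om. p i * G (L \<union> ?S) (fst i) z)
          = (\<Sum>x\<in>Om. \<Sum>y\<in>Om. p (x, y) * G (L \<union> ?S) x z)"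
        by (simp add: sum.cartesian_product case_prod_unfold)
      also have "\<dots> = (\<Sum>x\<in>Om. G L s x * G (L \<union> ?S) x z)"
        using p by (simp add: sum_distrib_right[symmetric] is_coupling_def)
      finally show ?thesis using G_tower[OF _ LSV z, of L s] by simp
    qed
    show "G L t z = (\<Sum>i\<in>Om \<times> Om. p i * G (L \<union> ?S) (snd i) z)" if z: "z \<in> Om" for z
    proof -
      have "(\<Sum>i\<in>Om \<times> Om. p i * G (L \<union> ?S) (snd i) z)
          = (\<Sum>x\<in>Om. \<Sum>y\<in>Om. p (x, y) * G (L \<union> ?S) y z)"
        by (simp add: sum.cartesian_product case_prod_unfold)
      also have "\<dots> = (\<Sum>y\<in>Om. \<Sum>x\<in>Om. p (x, y) * G (L \<union> ?S) y z)" by (rule sum.swap)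
      also have "\<dots> = (\<Sum>y\<in>Om. G L t y * G (L \<union> ?S) y z)"
        using p by (simp add: sum_distrib_right[symmetric] is_coupling_def)
      finally show ?thesis using G_tower[OF _ LSV z, of L t] by simp
    qed
    fix z assume z: "z \<in> Om \<times> Om" "0 < p z"
    obtain x y where xy: "z = (x, y)" "x \<in> Om" "y \<in> Om" using z by auto
    have "G L s x \<noteq> 0" "G L t y \<noteq> 0"
      using is_coupling_zero[OF finite_Om p xy(2,3)] z(2) xy(1) by auto
    then have wx: "wt L s x > 0" and wy: "wt L t y > 0"
      using G_pos[of L s x] G_pos[of L t y] G_nonneg[of L s x] G_nonneg[of L t y] by auto
    have xs: "w \<in> L \<Longrightarrow> x w = s w" and yt: "w \<in> L \<Longrightarrow> y w = t w" for w
      using wt_agree[of L s x w] wt_agree[of L t y w] wx wy by auto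
    define D where "D = {u\<in>?S. x u \<noteq> y u}"
    have hD: "hamming ?S x y = real (card D)" by (simp add: hamming_def D_def)
    have finD: "finite D" using finS by (simp add: D_def)
    have pos: "wt A x x > 0 \<and> wt A y y > 0 \<and> Z A x > 0 \<and> Z A y > 0"
      if "L \<subseteq> A" "A \<subseteq> V" for A
      using wt_pos_mono[OF that] Z_pos xy(2,3) wx wy by blast
    show "transport_le Om (hamming ?U) (G (L \<union> ?S) (fst z)) (G (L \<union> ?S) (snd z))
            (hamming ?S (fst z) (snd z) * (2 * B + F))"
    proof (cases "D = {}")
      case True
      have "transport_le Om (hamming (far v (Suc r))) (G (L \<union> ?S) x) (G (L \<union> ?S) y) 0"
      proof (rule transport_le_screened[where S = ?S])
        show "(a \<in> far v (Suc r) \<longrightarrow> b \<in> far v (Suc r) \<union> ?S) \<and>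
              (b \<in> far v (Suc r) \<longrightarrow> a \<in> far v (Suc r) \<union> ?S)" if "(a, b) \<in> Ed" for a b
          using adj_far[of a b v r] adj_far[of b a v r] that by (auto simp: adj_rel_def)
        have "v \<notin> far v (Suc r)" by (auto simp: far_def)
        then show "x w = y w" if "w \<in> (L \<union> ?S) \<inter> (far v (Suc r) \<union> ?S)" for w
          using that True vS xs[of w] yt[of w] st[of w] by (cases "w = v") (auto simp: D_def)
      qed (use pos[of "L \<union> ?S"] LSV far_subset in auto)
      then have "transport_le Om (hamming ?U) (G (L \<union> ?S) x) (G (L \<union> ?S) y) 0"
        by (rule transport_le_mono)
           (use hamming_mono[OF finite_far far_antimono[of "Suc r" R]] r in auto)
      then show ?thesis using hD True xy by simp
    next
      case False
      \<comment> \<open>Only the agreeing part of the sphere stays pinned, so on \<open>A\<close>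
        the configurations \<open>x\<close> and \<open>y\<close> differ at \<open>v\<close>
        alone.\<close>
      define A where "A = L \<union> (?S - D)"
      have AD: "L \<union> ?S = A \<union> D" by (auto simp: A_def D_def)
      have A: "L \<subseteq> A" "A \<subseteq> V" using LSV by (auto simp: A_def)
      have bd: "pair_bound u ?U B" if "u \<in> D" for u
        using pair_bound_mono[OF B(1) finite_far far_subset_far_sph] that by (auto simp: D_def)
      have X: "transport_le Om (hamming ?U) (G (A \<union> D) x) (G A x) (real (card D) * B)"
        and Y: "transport_le Om (hamming ?U) (G (A \<union> D) y) (G A y) (real (card D) * B)"
        using unpin_set[OF _ _ finite_far B(2) finD _ bd] xy(2,3) pos[OF A] AD LSV by auto
      have "x w = y w" if "w \<in> A - {v}" for w
        using that xs[of w] yt[of w] st[of w] by (auto simp: A_def D_def)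
      moreover have "x v \<noteq> y v" using xs[OF vL] yt[OF vL] pair by (auto simp: pin_pair_def)
      ultimately have "pin_pair A x y v"
        using A vL pos[OF A] xy(2,3) Om_less unfolding pin_pair_def by auto
      then have "transport_le Om (hamming ?U) (G A x) (G A y) F"
        using F(1) unfolding pair_bound_def by blast
      from transport_le_trans[OF finite_Om transport_le_trans[OF finite_Om X this
            hamming_triangle[OF finite_far]] transport_le_sym[OF Y hamming_commute]
            hamming_triangle[OF finite_far]]
      have "transport_le Om (hamming ?U) (G (A \<union> D) x) (G (A \<union> D) y)
          (real (card D) * B + F + real (card D) * B)" .
      \<comment> \<open>Charging \<open>F\<close> once per disagreement makes the cost proportional
        to \<open>card D\<close>, so that averaging over \<open>p\<close> yields the expected number
        of disagreements on the sphere.\<close>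
      moreover have "real (card D) * B + F + real (card D) * B \<le> real (card D) * (2 * B + F)"
      proof -
        have "card D \<ge> 1" using False finD by (simp add: Suc_leI card_gt_0_iff)
        then have "1 * F \<le> real (card D) * F" using F(2) by (intro mult_right_mono) auto
        then show ?thesis by (simp add: algebra_simps)
      qed
      ultimately show ?thesis using transport_le_mono unfolding hD AD xy fst_conv snd_conv
        by (metis order_refl)
    qed
  qed
  moreover have "(\<Sum>z\<in>Om \<times> Om. p z * (hamming ?S (fst z) (snd z) * (2 * B + F)))
      = exp_disagree Om p ?S * (2 * B + F)"
    by (simp add: exp_disagree_eq sum.cartesian_product case_prod_unfold sum_distrib_right mult.assoc)
  ultimately show ?thesis by simp
qed

section \<open>Disagreements sorted by distance\<close>

lemma exp_disagree_far:
  assumes v: "v \<in> V"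
  shows "exp_disagree Om p V = (\<Sum>r<R. exp_disagree Om p (sph v r)) + exp_disagree Om p (far v R)"
proof (induction R)
  case 0
  then show ?case by (simp add: far_0)
next
  case (Suc R)
  have "hamming (far v R) x y = hamming (sph v R) x y + hamming (far v (Suc R)) x y"
    for x y :: "'v \<Rightarrow> nat"
    unfolding far_split(1)[OF v, of R]
    using far_split(2)[OF v] finite_sph[OF v] finite_far
    by (simp add: hamming_eq_sum sum.union_disjoint)
  then have "exp_disagree Om p (far v R)
      = exp_disagree Om p (sph v R) + exp_disagree Om p (far v (Suc R))"
    by (simp add: exp_disagree_eq distrib_left sum.distrib)
  then show ?case using Suc by simp
qed

lemma exp_disagree_centre:
  assumes pair: "pin_pair L s t v" and p: "is_coupling Om p (G L s) (G L t)"
  shows "exp_disagree Om p {v} = 1"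
proof -
  have vL: "v \<in> L" "s v \<noteq> t v" and Zs: "Z L s > 0" using pair by (auto simp: pin_pair_def)
  have "p (x, y) * hamming {v} x y = p (x, y)" if xy: "x \<in> Om" "y \<in> Om" for x y
  proof (cases "p (x, y) = 0")
    case False
    then have "G L s x \<noteq> 0" "G L t y \<noteq> 0" using is_coupling_zero[OF finite_Om p xy] by auto
    then have "x v = s v" "y v = t v"
      using wt_agree vL(1) by (auto simp: gibbs_pin_def split: if_splits)
    then have "{u \<in> {v}. x u \<noteq> y u} = {v}" using vL(2) by auto
    then show ?thesis by (simp add: hamming_def)
  qed simp
  then have "exp_disagree Om p {v} = (\<Sum>x\<in>Om. \<Sum>y\<in>Om. p (x, y))"
    unfolding exp_disagree_eq by (intro sum.cong refl)
  also have "\<dots> = 1" using p sum_G[OF Zs] by (simp add: is_coupling_def)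
  finally show ?thesis .
qed

text \<open>The budget: the sure disagreement at \<open>v\<close> (the 1), the layers below
  \<open>R\<close> and the rest share a total that is at most \<open>C\<close> for the coupling
  provided by coupling independence.\<close>

lemma exp_disagree_layers:
  assumes pair: "pin_pair L s t v" and p: "is_coupling Om p (G L s) (G L t)" and R: "R > 0"
  shows "1 + (\<Sum>r\<in>{1..<R}. exp_disagree Om p (sph v r)) + exp_disagree Om p (far v R)
         = exp_disagree Om p V"
proof -
  have vV: "v \<in> V" using pair by (auto simp: pin_pair_def)
  have "{..<R} = insert 0 {1..<R}" using R by auto
  then show ?thesis
    using exp_disagree_far[OF vV, of p R] exp_disagree_centre[OF pair p] by (simp add: sph_0)
qed

text \<open>\<open>coupling_independence\<close> speaks of extensional functions on
  \<open>A\<close>, \<open>pin_pair\<close> of arbitrary ones; restricting to \<open>A\<close>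
  changes neither measure nor normaliser.\<close>

lemma coupling_independence_pair:
  assumes CI: "coupling_independence q V Ed Aedge Avert C" and pair: "pin_pair A s t v"
  obtains p where "is_coupling Om p (G A s) (G A t)" "exp_disagree Om p V \<le> C"
proof -
  let ?s = "restrict s A" and ?t = "restrict t A"
  have P: "A \<subseteq> V" "v \<in> A" "\<forall>w\<in>A. s w < q \<and> t w < q" "s v \<noteq> t v" "\<forall>w\<in>A - {v}. s w = t w"
    "Z A s > 0" "Z A t > 0" using pair by (auto simp: pin_pair_def)
  have "{w\<in>A. ?s w \<noteq> ?t w} = {v}" using P by auto
  then have d: "differ_exactly_one A ?s ?t" by (simp only: differ_exactly_one_def) simp
  have c: "?s \<in> configs q A" "?t \<in> configs q A" using P(3) by (auto simp: configs_def)
  have e: "G A ?s = G A s" "G A ?t = G A t" by (auto intro!: G_cong)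
  have z: "Z A ?s = Z A s" "Z A ?t = Z A t" by (auto intro!: Z_cong)
  show thesis
    using CI[unfolded coupling_independence_def, rule_format, OF P(1) c d] P(6,7) that
    unfolding e z by blast
qed

lemma exp_disagree_nonneg: "is_coupling Om p P Q \<Longrightarrow> exp_disagree Om p U \<ge> 0"
  unfolding exp_disagree_eq is_coupling_def by (intro sum_nonneg) (simp add: hamming_def)

end

section \<open>Exponential decay\<close>

lemma rate_bounds:
  fixes C x :: real
  assumes "C \<ge> 1" "x = 1 - 3 / (8 * C)"
  shows "0 < x" "x < 1" "C * (1 - x) = 3/8"
proof -
  have "3 / (8 * C) \<le> 3 / (8 * 1)" using assms(1) by (intro divide_left_mono) auto
  then show "0 < x" "x < 1" "C * (1 - x) = 3/8" using assms by auto
qed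

text \<open>The quadratic is \<open>\<integral>y=z..1. 12/25 - 4/25 * y\<close>, where the integrand is the tangent of
  \<open>1 / (2 + y)\<close> at \<open>y = 1/2\<close>; the term \<open>2/25 * x ^ R\<close> absorbs the discretisation error.\<close>

lemma layer_sum_ge:
  fixes C x :: real
  assumes C: "C \<ge> 1" and x: "x = 1 - 3 / (8 * C)" and R: "R \<ge> 1"
  shows "(8 * C / 3) * (2/5 - 12/25 * x ^ R + 2/25 * (x ^ R)\<^sup>2) + 2/25 * x ^ R + 3/5
         \<le> 1 + (\<Sum>r\<in>{1..<R}. x ^ r / (2 + x ^ r))"
  using R
proof (induction R rule: dec_induct)
  case base
  \<comment> \<open>At \<open>R = 1\<close> both sides equal 1: the terms in \<open>x\<close> cancel
    and \<open>2/5 + 3/5 = 1\<close>, which explains the constant \<open>3/5\<close>.\<close>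
  have "(8 * C / 3) * (2/5 - 12/25 * x + 2/25 * x\<^sup>2) = 8/3 * (C * (1 - x)) * (2/5 - 2/25 * x)"
    by (simp add: field_simps power2_eq_square)
  also have "\<dots> = 2/5 - 2/25 * x" by (simp add: rate_bounds(3)[OF C x])
  finally have "(8 * C / 3) * (2/5 - 12/25 * x + 2/25 * x\<^sup>2) = 2/5 - 2/25 * x" .
  moreover have "(\<Sum>r\<in>{1..<1}. x ^ r / (2 + x ^ r)) = 0" by simp
  ultimately show ?case unfolding power_one_right by linarith
next
  case (step R)
  define z where "z = x ^ R"
  have x01: "0 \<le> x" "x \<le> 1" using rate_bounds[OF C x] by auto
  have z: "0 \<le> z" "z \<le> 1" unfolding z_def using x01 by (auto simp: power_le_one)
  have zS: "x ^ Suc R = z - 3 / (8 * C) * z" unfolding z_def x by (simp add: algebra_simps)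
  \<comment> \<open>The step from \<open>z\<close> to \<open>x * z\<close> leaves the second-order
    error \<open>2/25 * (3 / (8 * C)) * z\<^sup>2\<close>, which the decrease
    \<open>2/25 * (3 / (8 * C)) * z\<close> of the correction term covers.\<close>
  have "z * z \<le> z" using z by (simp add: mult_left_le)
  then have "z * z / C \<le> z / C" using C by (simp add: divide_right_mono)
  then have "(8 * C / 3) * (2/5 - 12/25 * x ^ Suc R + 2/25 * (x ^ Suc R)\<^sup>2) + 2/25 * x ^ Suc R
      - ((8 * C / 3) * (2/5 - 12/25 * z + 2/25 * z\<^sup>2) + 2/25 * z) \<le> 12/25 * z - 4/25 * z\<^sup>2"
    using C unfolding zS by (simp add: field_simps power2_eq_square)
  \<comment> \<open>Tangent bound for a convex function: after multiplication by
    \<open>2 + z\<close> the gap is a square that vanishes at \<open>z = 1/2\<close>, times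
    \<open>z\<close>.\<close>
  also have "\<dots> \<le> z / (2 + z)"
  proof -
    have "(12/25 * z - 4/25 * z\<^sup>2) * (2 + z) = z - z * (1/5 - 2/5 * z)\<^sup>2"
      by (simp add: field_simps power2_eq_square)
    also have "\<dots> \<le> z" using z by simp
    finally show ?thesis using z by (simp add: pos_le_divide_eq)
  qed
  finally show ?case using step by (simp add: z_def)
qed

lemma layer_budget:
  fixes C x :: real
  assumes C: "C \<ge> 1" and x: "x = 1 - 3 / (8 * C)" and R: "R \<ge> 1"
  shows "C - 2/5 \<le> (\<Sum>r\<in>{1..<R}. x ^ r / (2 + x ^ r)) + 21/20 * C * x ^ R"
proof -
  define z where "z = x ^ R"
  have "0 \<le> z" unfolding z_def using rate_bounds[OF C x] by simp
  have "1 \<le> (8 / 3) * (2/5 - 12/25 * z + 2/25 * z\<^sup>2) + 21/20 * z"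
  proof -
    \<comment> \<open>\<open>69/128\<close> minimises the difference of the two sides as a quadratic
      in \<open>z\<close>; with the constant \<open>21/20\<close> this minimum is still
      positive.\<close>
    have "0 \<le> 16/75 * (z - 69/128)\<^sup>2" by simp
    then show ?thesis by (simp add: field_simps power2_eq_square)
  qed
  then have "C * 1 \<le> C * ((8 / 3) * (2/5 - 12/25 * z + 2/25 * z\<^sup>2) + 21/20 * z)"
    using C by (intro mult_left_mono) auto
  then show ?thesis using layer_sum_ge[OF assms] \<open>0 \<le> z\<close> unfolding z_def by (simp add: algebra_simps)
qed

section \<open>Iterating the recoupling inequality\<close>

context gibbs_system
begin

text \<open>The recursive inequality for \<open>f R\<close> has \<open>f R\<close> on both sides. Iterating the contraction
  below from the trivial bound \<open>C\<close> avoids having to know that the infimum is attained.\<close>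

lemma pair_bound_contract:
  assumes CI: "coupling_independence q V Ed Aedge Avert C" and C: "C \<ge> 1"
    and x: "x = 1 - 3 / (8 * C)" and R: "R \<ge> 1"
    and IH: "\<And>r v. r < R \<Longrightarrow> pair_bound v (far v r) (21/20 * C * x ^ r)"
    and F: "\<And>v. pair_bound v (far v R) F" "21/20 * C * x ^ R \<le> F"
  shows "pair_bound v (far v R) ((C - 7/10) / (C - 2/5) * F)"
  unfolding pair_bound_def
proof (intro allI impI)
  fix A s t assume pair: "pin_pair A s t v"
  define h where "h r = 21/20 * C * x ^ r" for r
  \<comment> \<open>Since \<open>7/10\<close> lies between \<open>2/5\<close> and 1, both
    \<open>\<rho> < 1\<close> and \<open>1 + \<rho> * (C - 2/5) > C\<close> hold; the latter gives
    the contradiction.\<close>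
  define \<rho> where "\<rho> = (C - 7/10) / (C - 2/5)"
  have x0: "0 < x" using rate_bounds[OF C x] by simp
  have h0: "h r > 0" for r using C x0 by (simp add: h_def)
  have F0: "F > 0" using F(2) h0[of R] by (simp add: h_def)
  have \<rho>0: "\<rho> > 0" using C by (simp add: \<rho>_def)
  obtain p where p: "is_coupling Om p (G A s) (G A t)" "exp_disagree Om p V \<le> C"
    using coupling_independence_pair[OF CI pair] .
  let ?E = "\<lambda>U. exp_disagree Om p U"
  show "transport_le Om (hamming (far v R)) (G A s) (G A t) ((C - 7/10) / (C - 2/5) * F)"
  proof (rule ccontr)
    \<comment> \<open>If no coupling reached \<open>\<rho> * F\<close>, then \<open>p\<close> itself
      and its recoupling at every radius would cost more, which bounds each layer of
      \<open>p\<close> from below; together the layers would exceed the budget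
      \<open>C\<close>.\<close>
    assume neg: "\<not> ?thesis"
    then have "?E (far v R) > \<rho> * F"
      using p(1) unfolding transport_le_hamming_iff \<rho>_def by (meson not_le)
    then have far: "?E (far v R) \<ge> \<rho> * h R"
      using F(2) \<rho>0 by (smt (verit) h_def mult_left_mono)
    have sph: "?E (sph v r) \<ge> \<rho> * (x ^ r / (2 + x ^ r))" if r: "r \<in> {1..<R}" for r
    proof -
      have "transport_le Om (hamming (far v R)) (G A s) (G A t)
          (?E (sph v r) * (2 * h (R - r) + F))"
        using r F0 h0[of "R - r"] unfolding h_def
        by (intro recouple[OF pair _ _ p(1)] IH F(1)) auto
      then have "\<not> ?E (sph v r) * (2 * h (R - r) + F) \<le> \<rho> * F"
        using neg transport_le_mono[OF _ _ order_refl] unfolding \<rho>_def by blast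
      then have "?E (sph v r) \<ge> \<rho> * F / (2 * h (R - r) + F)"
        using F0 h0[of "R - r"] by (simp add: pos_divide_le_eq)
      \<comment> \<open>The left side increases with \<open>F\<close>, so \<open>F\<close> may be
        lowered to \<open>h R\<close>; the ratio then depends on \<open>x ^ r\<close> alone.\<close>
      moreover have "F / (2 * h (R - r) + F) \<ge> h R / (2 * h (R - r) + h R)"
      proof -
        have "h R * h (R - r) \<le> F * h (R - r)"
          using F(2) h0[of "R - r"] by (intro mult_right_mono) (auto simp: h_def)
        then show ?thesis using F0 h0[of "R - r"] h0[of R] by (simp add: divide_simps algebra_simps)
      qed
      moreover have "h R / (2 * h (R - r) + h R) = x ^ r / (2 + x ^ r)"
      proof -
        have "h R = h (R - r) * x ^ r" using r by (simp add: h_def power_add[symmetric])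
        then have "h R / (2 * h (R - r) + h R) = (h (R - r) * x ^ r) / (h (R - r) * (2 + x ^ r))"
          by (simp add: algebra_simps)
        then show ?thesis using h0[of "R - r"] by simp
      qed
      ultimately show ?thesis using \<rho>0 by (smt (verit) mult_left_mono times_divide_eq_right)
    qed
    have "1 + \<rho> * (C - 2/5) \<le> 1 + \<rho> * ((\<Sum>r\<in>{1..<R}. x ^ r / (2 + x ^ r)) + h R)"
      using layer_budget[OF C x R] \<rho>0 by (simp add: h_def)
    also have "\<dots> = 1 + (\<Sum>r\<in>{1..<R}. \<rho> * (x ^ r / (2 + x ^ r))) + \<rho> * h R"
      by (simp only: distrib_left sum_distrib_left add.assoc)
    also have "\<dots> \<le> 1 + (\<Sum>r\<in>{1..<R}. ?E (sph v r)) + ?E (far v R)"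
      by (intro add_mono order_refl sum_mono far sph)
    also have "\<dots> \<le> C" using exp_disagree_layers[OF pair p(1)] R p(2) by simp
    finally have "1 + \<rho> * (C - 2/5) \<le> C" .
    moreover have "\<rho> * (C - 2/5) = C - 7/10" using C by (simp add: \<rho>_def)
    ultimately show False by simp
  qed
qed

lemma pair_bound_CI:
  assumes CI: "coupling_independence q V Ed Aedge Avert C" and U: "U \<subseteq> V"
  shows "pair_bound v U C"
proof -
  have "pair_bound v V C" unfolding pair_bound_def transport_le_hamming_iff
    using coupling_independence_pair[OF CI] by metis
  then show ?thesis using pair_bound_mono[OF _ finite_V U] by blast
qed

text \<open>For fixed \<open>R\<close> the contraction is iterated from the bound \<open>C\<close>.
  The maximum with \<open>h\<close> keeps \<open>F\<close> at least \<open>h\<close>, as the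
  contraction requires, and since \<open>\<rho> < 1\<close> it equals \<open>h\<close> after
  finitely many rounds.\<close>

lemma pair_bound_decay:
  assumes CI: "coupling_independence q V Ed Aedge Avert C" and C: "C \<ge> 1"
    and x: "x = 1 - 3 / (8 * C)"
  shows "pair_bound v (far v R) (21/20 * C * x ^ R)"
proof (induction R arbitrary: v rule: less_induct)
  case (less R)
  show ?case
  proof (cases "R = 0")
    case True
    then show ?thesis
      using pair_bound_mono[OF pair_bound_CI[OF CI far_subset] finite_far order_refl] C by simp
  next
    case False
    define h where "h = 21/20 * C * x ^ R"
    define \<rho> where "\<rho> = (C - 7/10) / (C - 2/5)"
    have \<rho>: "0 \<le> \<rho>" "\<rho> < 1" using C by (auto simp: \<rho>_def)
    have h0: "0 < h" using C rate_bounds[OF C x] by (simp add: h_def)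
    have "\<forall>v. pair_bound v (far v R) (max h (\<rho> ^ n * C))" for n
    proof (induction n)
      case 0
      then show ?case
        using pair_bound_mono[OF pair_bound_CI[OF CI far_subset] finite_far order_refl] by simp
    next
      case (Suc n)
      let ?F = "max h (\<rho> ^ n * C)"
      have "pair_bound v (far v R) (\<rho> * ?F)" for v
        using pair_bound_contract[OF CI C x _ less.IH, of R ?F v] Suc False
        unfolding \<rho>_def h_def by simp
      moreover have "\<rho> * ?F \<le> max h (\<rho> ^ Suc n * C)"
      proof -
        have "\<rho> * ?F = max (\<rho> * h) (\<rho> ^ Suc n * C)"
          using \<rho>(1) by (simp add: max_mult_distrib_left mult.assoc)
        moreover have "\<rho> * h \<le> h" using \<rho> h0 by (simp add: mult_left_le_one_le)
        ultimately show ?thesis by auto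
      qed
      ultimately show ?case using pair_bound_mono[OF _ finite_far order_refl] by blast
    qed
    moreover obtain n where "\<rho> ^ n < h / C"
      using real_arch_pow_inv[of "h / C" \<rho>] \<rho> h0 C by auto
    then have "max h (\<rho> ^ n * C) = h" using C by (simp add: field_simps)
    ultimately show ?thesis unfolding h_def by metis
  qed
qed

section \<open>From couplings to total variation\<close>

text \<open>The coupling inequality at one vertex: the right side is the probability under
  \<open>p\<close> that the two configurations differ at \<open>u\<close>.\<close>

lemma dtv_le_disagree:
  assumes p: "is_coupling Om p (G A s) (G A t)" and u: "u \<in> V"
  shows "dtv_spin q (gibbs_marginal q V Ed Aedge Avert A s u) (gibbs_marginal q V Ed Aedge Avert A t u)
         \<le> exp_disagree Om p {u}"
proof -
  let ?i = "\<lambda>b. if b then 1 else (0::real)"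
  have p0: "p z \<ge> 0" for z using p unfolding is_coupling_def by blast
  have m1: "gibbs_marginal q V Ed Aedge Avert A s u c = (\<Sum>x\<in>Om. \<Sum>y\<in>Om. p (x, y) * ?i (x u = c))" for c
  proof -
    have "gibbs_marginal q V Ed Aedge Avert A s u c = (\<Sum>x\<in>Om. if x u = c then G A s x else 0)"
      unfolding gibbs_marginal_def using finite_Om by (simp add: sum.inter_filter)
    also have "\<dots> = (\<Sum>x\<in>Om. (\<Sum>y\<in>Om. p (x, y)) * ?i (x u = c))"
      using p by (intro sum.cong) (auto simp: is_coupling_def)
    finally show ?thesis by (simp only: sum_distrib_right)
  qed
  have m2: "gibbs_marginal q V Ed Aedge Avert A t u c = (\<Sum>x\<in>Om. \<Sum>y\<in>Om. p (x, y) * ?i (y u = c))" for c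
  proof -
    have "gibbs_marginal q V Ed Aedge Avert A t u c = (\<Sum>y\<in>Om. if y u = c then G A t y else 0)"
      unfolding gibbs_marginal_def using finite_Om by (simp add: sum.inter_filter)
    also have "\<dots> = (\<Sum>y\<in>Om. (\<Sum>x\<in>Om. p (x, y)) * ?i (y u = c))"
      using p by (intro sum.cong) (auto simp: is_coupling_def)
    also have "\<dots> = (\<Sum>y\<in>Om. \<Sum>x\<in>Om. p (x, y) * ?i (y u = c))" by (simp only: sum_distrib_right)
    also have "\<dots> = (\<Sum>x\<in>Om. \<Sum>y\<in>Om. p (x, y) * ?i (y u = c))" by (rule sum.swap)
    finally show ?thesis .
  qed
  have "(\<Sum>c<q. \<bar>gibbs_marginal q V Ed Aedge Avert A s u c - gibbs_marginal q V Ed Aedge Avert A t u c\<bar>)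
      \<le> (\<Sum>c<q. \<Sum>z\<in>Om \<times> Om. p z * \<bar>?i (fst z u = c) - ?i (snd z u = c)\<bar>)"
  proof (rule sum_mono)
    fix c
    have "gibbs_marginal q V Ed Aedge Avert A s u c - gibbs_marginal q V Ed Aedge Avert A t u c
        = (\<Sum>z\<in>Om \<times> Om. p z * (?i (fst z u = c) - ?i (snd z u = c)))"
      unfolding m1 m2 sum.cartesian_product sum_subtractf[symmetric]
      by (intro sum.cong) (auto simp: algebra_simps)
    also have "\<bar>\<dots>\<bar> \<le> (\<Sum>z\<in>Om \<times> Om. \<bar>p z * (?i (fst z u = c) - ?i (snd z u = c))\<bar>)"
      by (rule sum_abs)
    also have "\<dots> = (\<Sum>z\<in>Om \<times> Om. p z * \<bar>?i (fst z u = c) - ?i (snd z u = c)\<bar>)"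
      using p0 by (simp add: abs_mult)
    finally show "\<bar>gibbs_marginal q V Ed Aedge Avert A s u c - gibbs_marginal q V Ed Aedge Avert A t u c\<bar>
        \<le> (\<Sum>z\<in>Om \<times> Om. p z * \<bar>?i (fst z u = c) - ?i (snd z u = c)\<bar>)" .
  qed
  also have "\<dots> = (\<Sum>z\<in>Om \<times> Om. p z * (\<Sum>c<q. \<bar>?i (fst z u = c) - ?i (snd z u = c)\<bar>))"
    by (subst sum.swap) (simp only: sum_distrib_left)
  \<comment> \<open>A disagreement at \<open>u\<close> counts at the two spins involved, an
    agreement at none; the 2 cancels the \<open>1/2\<close> in \<open>dtv_spin\<close>.\<close>
  also have "\<dots> \<le> (\<Sum>z\<in>Om \<times> Om. p z * (2 * hamming {u} (fst z) (snd z)))"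
  proof (intro sum_mono mult_left_mono p0)
    fix z assume z: "z \<in> Om \<times> Om"
    have "(\<Sum>c<q. \<bar>?i (a = c) - ?i (b = c)\<bar>) \<le> 2 * ?i (a \<noteq> b)" if "a < q" "b < q" for a b
    proof (cases "a = b")
      case False
      have "(\<Sum>c<q. \<bar>?i (a = c) - ?i (b = c)\<bar>) \<le> (\<Sum>c<q. ?i (a = c) + ?i (b = c))"
        by (intro sum_mono) auto
      also have "\<dots> = 2" using that by (simp add: sum.distrib)
      finally show ?thesis using False by simp
    qed simp
    from this[of "fst z u" "snd z u"]
    show "(\<Sum>c<q. \<bar>?i (fst z u = c) - ?i (snd z u = c)\<bar>) \<le> 2 * hamming {u} (fst z) (snd z)"
      using z u Om_less by (simp add: hamming_eq_sum mem_Times_iff)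
  qed
  also have "\<dots> = 2 * exp_disagree Om p {u}"
    by (simp add: exp_disagree_eq sum.cartesian_product case_prod_unfold sum_distrib_left algebra_simps)
  finally show ?thesis by (simp add: dtv_spin_def)
qed

lemma exp_disagree_eq_pairs:
  "exp_disagree Om p S = (\<Sum>z\<in>Om \<times> Om. p z * hamming S (fst z) (snd z))"
  by (simp add: exp_disagree_eq sum.cartesian_product case_prod_unfold)

lemma exp_disagree_sum:
  assumes "finite S"
  shows "exp_disagree Om p S = (\<Sum>u\<in>S. exp_disagree Om p {u})"
proof -
  have "exp_disagree Om p S = (\<Sum>z\<in>Om \<times> Om. \<Sum>u\<in>S. p z * hamming {u} (fst z) (snd z))"
    unfolding exp_disagree_eq_pairs sum_distrib_left[symmetric]
    using assms by (simp add: hamming_eq_sum)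
  also have "\<dots> = (\<Sum>u\<in>S. \<Sum>z\<in>Om \<times> Om. p z * hamming {u} (fst z) (snd z))" by (rule sum.swap)
  finally show ?thesis by (simp add: exp_disagree_eq_pairs)
qed

section \<open>The bound on a sphere\<close>

lemma sphere_coupling:
  assumes CI: "coupling_independence q V Ed Aedge Avert C"
    and pair: "pin_pair L s t v" and R: "R > 0"
  obtains p where "is_coupling Om p (G L s) (G L t)"
    "exp_disagree Om p (sph v R) \<le> 2 * C * (1/2) powr real_of_int \<lceil>real R / (2 * C)\<rceil>"
proof -
  have vV: "v \<in> V" using pair by (auto simp: pin_pair_def)
  obtain p where p: "is_coupling Om p (G L s) (G L t)" "exp_disagree Om p V \<le> C"
    using coupling_independence_pair[OF CI pair] .
  \<comment> \<open>The pair itself forces this, since every coupling disagrees at \<open>v\<close>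
    almost surely.\<close>
  have C: "C \<ge> 1"
  proof -
    have "1 + exp_disagree Om p (far v 1) \<le> C" using exp_disagree_layers[OF pair p(1), of 1] p(2) by simp
    then show ?thesis using exp_disagree_nonneg[OF p(1)] by (smt (verit))
  qed
  \<comment> \<open>One less than the ceiling: the spare factor \<open>1/2\<close> absorbs the 2 of
    \<open>2 * C\<close>, and \<open>j * (2 * C) < R\<close> holds strictly.\<close>
  define j where "j = nat (\<lceil>real R / (2 * C)\<rceil> - 1)"
  have "\<lceil>real R / (2 * C)\<rceil> \<ge> 1" using R C by simp
  then have k: "real_of_int \<lceil>real R / (2 * C)\<rceil> = real (Suc j)" by (simp add: j_def)
  then have jR: "real j * (2 * C) < real R" using C
    by (smt (verit) ceiling_correct of_nat_Suc pos_less_divide_eq)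
  have rhs: "2 * C * (1/2) powr real_of_int \<lceil>real R / (2 * C)\<rceil> = C * (1/2) ^ j"
    unfolding k by (subst powr_realpow) auto
  have "pair_bound v (far v R) (C * (1/2) ^ j)"
  proof (cases "j = 0")
    case True
    then show ?thesis using pair_bound_CI[OF CI far_subset] by simp
  next
    case False
    define x where "x = 1 - 3 / (8 * C)"
    have x0: "0 \<le> x" using rate_bounds[OF C x_def] by simp
    \<comment> \<open>The bound thus loses a factor \<open>exp (3/4)\<close> for every
      \<open>2 * C\<close> units of distance.\<close>
    have "x \<le> exp (- (3 / (8 * C)))" unfolding x_def using exp_ge_add_one_self[of "- (3 / (8 * C))"] by simp
    then have "x ^ R \<le> exp (- (3 / (8 * C))) ^ R" using x0 by (rule power_mono)
    also have "\<dots> = exp (- (3 / (8 * C) * real R))" by (simp add: exp_of_nat_mult[symmetric] mult.commute)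
    also have "\<dots> \<le> exp (- (3 / 4) * real j)"
    proof -
      have "3 / (8 * C) * (real j * (2 * C)) \<le> 3 / (8 * C) * real R"
        using jR C by (intro mult_left_mono) auto
      then show ?thesis using C by simp
    qed
    also have "\<dots> = (exp (- (3 / 4))) ^ j" by (simp add: exp_of_nat_mult[symmetric] mult.commute)
    also have "\<dots> \<le> (10 / 21) ^ j"
    proof (rule power_mono)
      \<comment> \<open>At \<open>3/4\<close> the quadratic Taylor bound gives only about 2.03,
        short of \<open>21/10\<close>; at \<open>3/16\<close>, followed by a fourth power, it
        suffices.\<close>
      have "241/200 \<le> exp (3/16 :: real)"
        using exp_lower_Taylor_quadratic[of "3/16 :: real"] by (simp add: power2_eq_square)
      then have "(241/200) ^ 4 \<le> exp (3/16 :: real) ^ 4" by (intro power_mono) auto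
      also have "\<dots> = exp (3/4)" by (simp add: exp_of_nat_mult[symmetric])
      finally have "21/10 \<le> exp (3/4 :: real)" by (simp add: power_divide)
      then show "exp (- (3 / 4)) \<le> (10 / 21 :: real)" by (simp add: exp_minus field_simps)
    qed simp
    finally have "21/20 * C * x ^ R \<le> 21/20 * C * (10 / 21) ^ j" using C by simp
    also have "\<dots> = C * (1/2) ^ j * (21/20 * (20/21) ^ j)"
    proof -
      have "(10 / 21 :: real) ^ j = (1/2) ^ j * (20/21) ^ j" by (simp add: power_mult_distrib[symmetric])
      then show ?thesis by simp
    qed
    also have "\<dots> \<le> C * (1/2) ^ j * 1"
    proof (rule mult_left_mono)
      \<comment> \<open>As \<open>j\<close> is at least 1, one factor \<open>20/21\<close> is
        available to cancel the prefactor \<open>21/20\<close>.\<close>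
      have "(20/21::real) ^ j \<le> (20/21) ^ 1" using False by (intro power_decreasing) auto
      then show "21/20 * (20/21::real) ^ j \<le> 1" by simp
    qed (use C in simp)
    finally show ?thesis
      using pair_bound_mono[OF pair_bound_decay[OF CI C x_def] finite_far order_refl] by simp
  qed
  then have "pair_bound v (sph v R) (C * (1/2) ^ j)"
    using pair_bound_mono[OF _ finite_far sph_subset_far[OF vV] order_refl] by blast
  then show thesis
    using that pair unfolding pair_bound_def transport_le_hamming_iff rhs by blast
qed

end

theorem theorem3p2:
  fixes q :: nat and V :: "'v set" and Ed :: "('v \<times> 'v) set"
    and Aedge :: "nat \<Rightarrow> nat \<Rightarrow> real" and Avert :: "nat \<Rightarrow> real"
    and C :: real and R :: nat and L :: "'v set" and sig tau :: "'v \<Rightarrow> nat" and v :: 'v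
  assumes sys: "spin_system q V Ed Aedge Avert"
    and CI: "coupling_independence q V Ed Aedge Avert C"
    and Cpos: "C > 0"
    and Rpos: "R > 0"
    and LV: "L \<subseteq> V"
    and sig: "sig \<in> configs q L" and tau: "tau \<in> configs q L"
    and vL: "v \<in> L" and diff_v: "sig v \<noteq> tau v"
    and agree: "\<forall>w\<in>L - {v}. sig w = tau w"
    and Zsig: "pin_Z q V Ed Aedge Avert L sig > 0" and Ztau: "pin_Z q V Ed Aedge Avert L tau > 0"
  shows "(\<exists>p. is_coupling (configs q V) p (gibbs_pin q V Ed Aedge Avert L sig) (gibbs_pin q V Ed Aedge Avert L tau)
            \<and> exp_disagree (configs q V) p (graph_sphere Ed v R)
                \<le> 2 * C * (1/2) powr real_of_int \<lceil>real R / (2 * C)\<rceil>)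
         \<and> (\<forall>l::nat. l > 0 \<longrightarrow>
              (\<Sum>u\<in>graph_sphere Ed v l. dtv_spin q (gibbs_marginal q V Ed Aedge Avert L sig u)
                                             (gibbs_marginal q V Ed Aedge Avert L tau u))
                \<le> 2 * C * 2 powr (- real_of_int \<lceil>real l / (2 * C)\<rceil>))"
proof -
  interpret gibbs_system q V Ed Aedge Avert by unfold_locales (rule sys)
  have pair: "pin_pair L sig tau v"
    using assms by (auto simp: pin_pair_def configs_def)
  have vV: "v \<in> V" using LV vL by blast
  have "(\<Sum>u\<in>sph v l. dtv_spin q (gibbs_marginal q V Ed Aedge Avert L sig u)
           (gibbs_marginal q V Ed Aedge Avert L tau u))
        \<le> 2 * C * 2 powr (- real_of_int \<lceil>real l / (2 * C)\<rceil>)" if l: "l > 0" for l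
  proof -
    \<comment> \<open>Each radius \<open>l\<close> gets a coupling of its own; the marginals do not
      depend on this choice.\<close>
    obtain p where p: "is_coupling Om p (G L sig) (G L tau)"
      "exp_disagree Om p (sph v l) \<le> 2 * C * (1/2) powr real_of_int \<lceil>real l / (2 * C)\<rceil>"
      using sphere_coupling[OF CI pair l] .
    have "(\<Sum>u\<in>sph v l. dtv_spin q (gibbs_marginal q V Ed Aedge Avert L sig u)
           (gibbs_marginal q V Ed Aedge Avert L tau u)) \<le> (\<Sum>u\<in>sph v l. exp_disagree Om p {u})"
      using dtv_le_disagree[OF p(1)] sph_subset[OF vV] by (intro sum_mono) blast
    also have "\<dots> = exp_disagree Om p (sph v l)" using exp_disagree_sum[OF finite_sph[OF vV]] by simp
    also have "\<dots> \<le> 2 * C * (1/2) powr real_of_int \<lceil>real l / (2 * C)\<rceil>" by (rule p(2))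
    finally show ?thesis by (simp add: powr_minus_divide powr_divide)
  qed
  then show ?thesis using sphere_coupling[OF CI pair Rpos] by blast
qed

end
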